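(* For every positive integer $n$ there is a homotopy equivalence $$\Sigma Y[n]\;\simeq\;\Sigma\left(\bigvee_{k=1}^{n}\binom{n}{k}\,\Sigma S(kL)\right),$$ where $Y[n]=\operatorname{Hom}(\mathbb{Z}^n,SU(2))$ is the space of commuting $n$-tuples in $SU(2)$, $L$ is the canonical line bundle over $\mathbb{R}P^2$, and $S(kL)$ is the sphere bundle of the $k$-fold Whitney sum $kL$.
   Context: $Y[n]:=\{(g_1,\dots,g_n)\in SU(2)^n \mid g_ig_j=g_jg_i \text{ for all } i,j\}$, with the subspace topology from $SU(2)^n$. $L$ is the canonical (tautological) real line bundle over $\mathbb{R}P^2$, $kL=L\oplus\cdots\oplus L$ ($k$ summands), and $S(kL)$ is the total space of its unit sphere bundle (for a Euclidean metric on $kL$). $\Sigma$ denotes suspension; $\Sigma S(kL)$ arises as the unreduced suspension of $S(kL)$ (the quotient of $S(kL)\times[0,1]$ collapsing the two ends to two distinct points), which is homotopy equivalent to the reduced one. For a pointed space $X$ and an integer $m\ge 0$, the notation $m\,X$ inside a wedge means the wedge of $m$ copies of $X$; so $\bigvee_{k=1}^n\binom{n}{k}X_k$ is the wedge containing $\binom{n}{k}$ copies of $X_k$ for each $k=1,\dots,n$. *)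

theory Defs
  imports "HOL-Analysis.Analysis"
begin

section \<open>Quotient spaces\<close>

definition quotient_topology :: "'a topology \<Rightarrow> ('a \<Rightarrow> 'b) \<Rightarrow> 'b topology" where
  "quotient_topology X q =
     topology (\<lambda>U. U \<subseteq> q ` topspace X \<and> openin X {x \<in> topspace X. q x \<in> U})"

lemma openin_quotient_topology:
  "openin (quotient_topology X q) U \<longleftrightarrow>
     U \<subseteq> q ` topspace X \<and> openin X {x \<in> topspace X. q x \<in> U}"
proof -
  have "istopology (\<lambda>U. U \<subseteq> q ` topspace X \<and> openin X {x \<in> topspace X. q x \<in> U})"
    unfolding istopology_def
  proof (intro conjI allI impI)
    fix S T
    assume S: "S \<subseteq> q ` topspace X \<and> openin X {x \<in> topspace X. q x \<in> S}"
      and T: "T \<subseteq> q ` topspace X \<and> openin X {x \<in> topspace X. q x \<in> T}"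
    show "S \<inter> T \<subseteq> q ` topspace X"
      using S by blast
    have "{x \<in> topspace X. q x \<in> S \<inter> T}
        = {x \<in> topspace X. q x \<in> S} \<inter> {x \<in> topspace X. q x \<in> T}"
      by auto
    then show "openin X {x \<in> topspace X. q x \<in> S \<inter> T}"
      using S T by (simp add: openin_Int)
  next
    fix K
    assume K: "\<forall>S\<in>K. S \<subseteq> q ` topspace X \<and> openin X {x \<in> topspace X. q x \<in> S}"
    show "\<Union>K \<subseteq> q ` topspace X"
      using K by (simp add: Sup_le_iff)
    have "{x \<in> topspace X. q x \<in> \<Union>K} = (\<Union>S\<in>K. {x \<in> topspace X. q x \<in> S})"
      by auto
    moreover have "openin X (\<Union>S\<in>K. {x \<in> topspace X. q x \<in> S})"
      using K by (intro openin_Union) auto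
    ultimately show "openin X {x \<in> topspace X. q x \<in> \<Union>K}"
      by simp
  qed
  then show ?thesis
    unfolding quotient_topology_def by (simp only: topology_inverse')
qed

lemma topspace_quotient_topology [simp]:
  "topspace (quotient_topology X q) = q ` topspace X"
proof
  show "topspace (quotient_topology X q) \<subseteq> q ` topspace X"
    using openin_topspace[of "quotient_topology X q"] by (simp only: openin_quotient_topology)
  have "{x \<in> topspace X. q x \<in> q ` topspace X} = topspace X"
    by auto
  then have "openin (quotient_topology X q) (q ` topspace X)"
    by (simp only: openin_quotient_topology) simp
  then show "q ` topspace X \<subseteq> topspace (quotient_topology X q)"
    by (rule openin_subset)
qed

lemma quotient_map_quotient_topology: "quotient_map X (quotient_topology X q) q"
  unfolding quotient_map_def openin_quotient_topology by simp

definition quotient_space :: "'a topology \<Rightarrow> ('a \<times> 'a) set \<Rightarrow> 'a set topology" where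
  "quotient_space X r = quotient_topology X (\<lambda>x. r `` {x})"

lemma topspace_quotient_space: "topspace (quotient_space X r) = topspace X // r"
  by (auto simp: quotient_space_def quotient_def)


section \<open>Unreduced suspension and wedge\<close>

definition suspension_rel :: "'a topology \<Rightarrow> (('a \<times> real) \<times> ('a \<times> real)) set" where
  "suspension_rel X =
     {((x, s), (y, t)). x \<in> topspace X \<and> y \<in> topspace X \<and> s \<in> {0..1} \<and> t \<in> {0..1} \<and>
        s = t \<and> (x = y \<or> s = 0 \<or> s = 1)}"

lemma equiv_suspension_rel: "equiv (topspace X \<times> {0..1}) (suspension_rel X)"
proof (rule equivI)
  show "suspension_rel X \<subseteq> (topspace X \<times> {0..1}) \<times> (topspace X \<times> {0..1})"
    by (auto simp: suspension_rel_def)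
  show "refl_on (topspace X \<times> {0..1}) (suspension_rel X)"
    by (rule refl_onI) (auto simp: suspension_rel_def)
  show "sym (suspension_rel X)"
    by (rule symI) (auto simp: suspension_rel_def)
  show "trans (suspension_rel X)"
    by (rule transI) (auto simp: suspension_rel_def)
qed

definition suspension :: "'a topology \<Rightarrow> ('a \<times> real) set topology" where
  "suspension X = quotient_space (prod_topology X (top_of_set {0..1})) (suspension_rel X)"

text \<open>The base point of a suspension is the cone point at parameter \<open>0\<close>.\<close>

definition suspension_point :: "'a topology \<Rightarrow> ('a \<times> real) set" where
  "suspension_point X = topspace X \<times> {0}"

lemma suspension_point_in_topspace:
  assumes "topspace X \<noteq> {}"
  shows "suspension_point X \<in> topspace (suspension X)"
proof -
  obtain x where x: "x \<in> topspace X"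
    using assms by blast
  have "suspension_rel X `` {(x, 0)} = suspension_point X"
    using x by (auto simp: suspension_rel_def suspension_point_def)
  moreover have "suspension_rel X `` {(x, 0)} \<in> (topspace X \<times> {0..1}) // suspension_rel X"
    by (rule quotientI) (use x in simp)
  ultimately show ?thesis
    by (simp add: suspension_def topspace_quotient_space)
qed

definition wedge_rel :: "('i \<Rightarrow> 'a topology) \<Rightarrow> ('i \<Rightarrow> 'a) \<Rightarrow> 'i set \<Rightarrow> (('i \<times> 'a) \<times> ('i \<times> 'a)) set" where
  "wedge_rel X p I =
     {((i, x), (j, y)). i \<in> I \<and> j \<in> I \<and> x \<in> topspace (X i) \<and> y \<in> topspace (X j) \<and>
        ((i, x) = (j, y) \<or> x = p i \<and> y = p j)}"

lemma equiv_wedge_rel: "equiv (Sigma I (topspace \<circ> X)) (wedge_rel X p I)"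
proof (rule equivI)
  show "wedge_rel X p I \<subseteq> Sigma I (topspace \<circ> X) \<times> Sigma I (topspace \<circ> X)"
    by (auto simp: wedge_rel_def)
  show "refl_on (Sigma I (topspace \<circ> X)) (wedge_rel X p I)"
    by (rule refl_onI) (auto simp: wedge_rel_def)
  show "sym (wedge_rel X p I)"
    by (rule symI) (auto simp: wedge_rel_def)
  show "trans (wedge_rel X p I)"
    by (rule transI) (auto simp: wedge_rel_def)
qed

definition wedge :: "('i \<Rightarrow> 'a topology) \<Rightarrow> ('i \<Rightarrow> 'a) \<Rightarrow> 'i set \<Rightarrow> ('i \<times> 'a) set topology" where
  "wedge X p I = quotient_space (sum_topology X I) (wedge_rel X p I)"


section \<open>Commuting tuples in SU(2)\<close>

definition conj_transpose :: "complex^'n^'m \<Rightarrow> complex^'m^'n" where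
  "conj_transpose A = (\<chi> i j. cnj (A $ j $ i))"

definition SU2 :: "(complex^2^2) set" where
  "SU2 = {A. conj_transpose A ** A = mat 1 \<and> A ** conj_transpose A = mat 1 \<and> det A = 1}"

definition commuting_tuples :: "nat \<Rightarrow> (nat \<Rightarrow> complex^2^2) topology" where
  "commuting_tuples n =
     subtopology (product_topology (\<lambda>_. top_of_set SU2) {..<n})
       {g. \<forall>i<n. \<forall>j<n. g i ** g j = g j ** g i}"


section \<open>Sums of the tautological line bundle over the real projective plane\<close>

definition RP2 :: "(real^3) set topology" where
  "RP2 = quotient_topology (top_of_set (sphere 0 1)) (\<lambda>x. span {x})"

definition taut_line_bundle :: "((real^3) set \<times> (real^3)) topology" where
  "taut_line_bundle = subtopology (prod_topology RP2 euclidean) {(l, v). v \<in> l}"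

text \<open>The total space of the \<open>k\<close>-fold Whitney sum: its fibre over a line \<open>l\<close> is \<open>l\<^sup>k\<close>, and it is
  topologised as a subspace of the trivial bundle \<open>RP2 \<times> (\<real>\<^sup>3)\<^sup>k\<close>.\<close>

definition taut_sum :: "nat \<Rightarrow> ((real^3) set \<times> (nat \<Rightarrow> real^3)) topology" where
  "taut_sum k =
     subtopology (prod_topology RP2 (product_topology (\<lambda>_. euclidean) {..<k}))
       {(l, v). \<forall>i<k. (l, v i) \<in> topspace taut_line_bundle}"

definition taut_sphere_bundle :: "nat \<Rightarrow> ((real^3) set \<times> (nat \<Rightarrow> real^3)) topology" where
  "taut_sphere_bundle k = subtopology (taut_sum k) {(l, v). (\<Sum>i<k. (norm (v i))\<^sup>2) = 1}"

end

theory Submission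
  imports Defs
begin

text \<open>
  Let \<open>Y\<close> be the space of commuting \<open>n\<close>-tuples. Two facts give the splitting.

  The cells. The group \<open>SU(2)\<close> is the unit sphere of the quaternions, and two elements commute iff
  their imaginary parts are parallel. A map \<open>ball_to_SU2\<close> from the closed unit ball of \<open>\<real>\<^sup>3\<close> to
  \<open>SU(2)\<close>, radial in the imaginary directions, collapses the boundary sphere to \<open>1\<close> and is injective
  inside. Hence commuting \<open>k\<close>-tuples without an entry \<open>1\<close> are \<open>k\<close>-tuples of vectors in the open unit
  ball that lie on a common line. For a set \<open>T\<close> of \<open>k\<close> indices, take the commuting tuples with
  entries \<open>1\<close> outside \<open>T\<close>, and collapse those which have an entry \<open>1\<close> at some index in \<open>T\<close>: by
  polar coordinates in the product of these balls this is the unreduced suspension of \<open>S(kL)\<close>.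

  The splitting. If a space retracts onto a subspace \<open>A\<close> that is well placed in it, then its suspension
  depends, up to homotopy, only on \<open>A\<close> and on the quotient by \<open>A\<close>
  (\<open>common_quotients.suspension_homotopy_equivalent\<close>). For spaces \<open>X\<close> and \<open>Y\<close> with the same \<open>A\<close>
  and the same quotient, write meridians of a suspension as paths from pole to pole, and let \<open>r\<close>, \<open>r'\<close>
  be the retractions. The equivalence sends the meridian of \<open>x\<close> to the path that goes up the
  meridian of \<open>r x\<close>, down that of \<open>r' x'\<close>, and up that of \<open>x'\<close>, where \<open>x'\<close> is the point of \<open>Y\<close> that
  corresponds to \<open>x\<close>. As \<open>x\<close> approaches \<open>A\<close>, the way down is cut off earlier and earlier, so that
  only the meridian of \<open>r x\<close> remains on \<open>A\<close>. The map back has the same form with the roles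
  exchanged, and in the composite the unwanted meridians cancel.

  This is applied \<open>n\<close> times. The spaces \<open>stage n k\<close> interpolate between \<open>Y\<close>, for \<open>k = 0\<close>, and the
  wedge of the cells, for \<open>k = n\<close>. Going from \<open>k\<close> to \<open>k + 1\<close> replaces a space \<open>Z\<close> by the wedge of \<open>A\<close> and
  \<open>Z / A\<close>, where \<open>A\<close> consists of the tuples whose entry at \<open>k\<close> is \<open>1\<close>. Both spaces retract
  onto \<open>A\<close>, and both have the quotient \<open>Z / A\<close> (\<open>stage_step_quotients\<close>). Finally \<open>stage n n\<close> is
  homeomorphic to the wedge in the theorem, since both are quotients of one compact space
  with the same fibres (\<open>last_stage_homeomorphic_wedge\<close>).
\<close>


section \<open>Suspensions\<close>

lemma continuous_map_from_sum_topology: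
  "continuous_map (sum_topology X I) Y f \<longleftrightarrow> (\<forall>i\<in>I. continuous_map (X i) Y (\<lambda>x. f (i, x)))"
proof
  assume "continuous_map (sum_topology X I) Y f"
  then show "\<forall>i\<in>I. continuous_map (X i) Y (\<lambda>x. f (i, x))"
    using continuous_map_compose[OF continuous_map_component_injection, of _ I X Y f]
    by (auto simp: o_def)
next
  assume L: "\<forall>i\<in>I. continuous_map (X i) Y (\<lambda>x. f (i, x))"
  show "continuous_map (sum_topology X I) Y f"
    unfolding continuous_map_def
  proof (intro conjI allI impI)
    show "f \<in> topspace (sum_topology X I) \<rightarrow> topspace Y"
      using L by (fastforce simp: continuous_map_def)
    fix U assume U: "openin Y U"
    have "{x. (i, x) \<in> {p \<in> topspace (sum_topology X I). f p \<in> U}} =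
        {x \<in> topspace (X i). f (i, x) \<in> U}" if "i \<in> I" for i
      using that by auto
    with L U show "openin (sum_topology X I) {p \<in> topspace (sum_topology X I). f p \<in> U}"
      unfolding openin_sum_topology by (auto simp: continuous_map_def)
  qed
qed

lemma continuous_map_three_cases:
  assumes "continuous_map T Y a" "continuous_map T Y b" "continuous_map T Y c"
    and "continuous_map T euclideanreal \<tau>" and "u < v"
    and "\<And>p. p \<in> topspace T \<Longrightarrow> \<tau> p = u \<Longrightarrow> a p = b p"
    and "\<And>p. p \<in> topspace T \<Longrightarrow> \<tau> p = v \<Longrightarrow> b p = c p"
  shows "continuous_map T Y (\<lambda>p. if \<tau> p \<le> u then a p else if \<tau> p \<le> v then b p else c p)"
proof (rule continuous_map_cases_le)
  show "continuous_map (subtopology T {x \<in> topspace T. u \<le> \<tau> x}) Y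
      (\<lambda>p. if \<tau> p \<le> v then b p else c p)"
    by (rule continuous_map_from_subtopology, rule continuous_map_cases_le)
       (use assms in \<open>auto intro: continuous_map_from_subtopology\<close>)
qed (use assms in \<open>auto intro: continuous_map_from_subtopology\<close>)

lemma continuous_map_two_cases:
  assumes "continuous_map T Y a" "continuous_map T Y b"
    and "continuous_map T euclideanreal \<tau>"
    and "\<And>p. p \<in> topspace T \<Longrightarrow> \<tau> p = u \<Longrightarrow> a p = b p"
  shows "continuous_map T Y (\<lambda>p. if \<tau> p \<le> u then a p else b p)"
  by (rule continuous_map_cases_le) (use assms in \<open>auto intro: continuous_map_from_subtopology\<close>)

text \<open>The point at height \<open>t\<close> on the meridian through \<open>x\<close>. Heights are clamped to the unit
  interval, so that a formula for a height may leave it.\<close>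

definition sus :: "'a topology \<Rightarrow> 'a \<Rightarrow> real \<Rightarrow> ('a \<times> real) set" where
  "sus X x t = suspension_rel X `` {(x, max 0 (min 1 t))}"

lemma sus_eq_iff:
  assumes "x \<in> topspace X" "y \<in> topspace X" "s \<in> {0..1}" "t \<in> {0..1}"
  shows "sus X x s = sus X y t \<longleftrightarrow> s = t \<and> (x = y \<or> s = 0 \<or> s = 1)"
proof -
  have "sus X x s = sus X y t \<longleftrightarrow> ((x, s), (y, t)) \<in> suspension_rel X"
    using assms eq_equiv_class_iff[OF equiv_suspension_rel, of "(x,s)" X "(y,t)"]
    by (simp add: sus_def)
  then show ?thesis
    using assms by (auto simp: suspension_rel_def)
qed

lemma sus_clamp: "max 0 (min 1 s) = max 0 (min 1 t) \<Longrightarrow> sus X x s = sus X x t"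
  by (simp add: sus_def)

lemma sus_low: "\<lbrakk>x \<in> topspace X; y \<in> topspace X; s \<le> 0; t \<le> 0\<rbrakk> \<Longrightarrow> sus X x s = sus X y t"
  using sus_eq_iff[of x X y 0 0] sus_clamp[of s 0 X x] sus_clamp[of t 0 X y] by auto

lemma sus_high: "\<lbrakk>x \<in> topspace X; y \<in> topspace X; s \<ge> 1; t \<ge> 1\<rbrakk> \<Longrightarrow> sus X x s = sus X y t"
  using sus_eq_iff[of x X y 1 1] sus_clamp[of s 1 X x] sus_clamp[of t 1 X y] by auto

lemma quotient_map_sus:
  "quotient_map (prod_topology X (top_of_set {0..1})) (suspension X) (\<lambda>(x, t). sus X x t)"
  unfolding suspension_def quotient_space_def
  by (rule quotient_map_eq[OF quotient_map_quotient_topology]) (auto simp: sus_def)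

lemma continuous_map_sus [continuous_intros]:
  assumes w: "continuous_map T X w" and c: "continuous_map T euclideanreal c"
  shows "continuous_map T (suspension X) (\<lambda>p. sus X (w p) (c p))"
proof -
  have "continuous_map T (prod_topology X (top_of_set {0..1}))
      (\<lambda>p. (w p, max 0 (min 1 (c p))))"
    unfolding continuous_map_pairwise o_def fst_conv snd_conv
    by (intro conjI w continuous_map_into_subtopology continuous_map_real_max
        continuous_map_real_min c) auto
  from continuous_map_compose[OF this quotient_imp_continuous_map[OF quotient_map_sus]]
  show ?thesis
    by (simp add: o_def sus_def)
qed

lemma topspace_suspension:
  "topspace (suspension X) = (\<lambda>(x, t). sus X x t) ` (topspace X \<times> {0..1})"
  using quotient_imp_surjective_map[OF quotient_map_sus, of X] by simp

text \<open>The unit interval is locally compact, hence the product with it preserves quotient maps.\<close>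

lemma quotient_map_sus_compose:
  assumes "quotient_map S X q"
  shows "quotient_map (prod_topology S (top_of_set {0..1})) (suspension X) (\<lambda>(s, t). sus X (q s) t)"
proof -
  have "quotient_map (prod_topology S (top_of_set {0..1::real}))
     (prod_topology X (top_of_set {0..1})) (\<lambda>(s, t). (q s, t))"
    by (rule quotient_map_prod_left)
      (auto simp: assms locally_compact_space_euclidean compact_imp_locally_compact_space compact_space_subtopology
        Hausdorff_space_subtopology)
  from quotient_map_compose[OF this quotient_map_sus] show ?thesis
    by (simp add: o_def case_prod_unfold)
qed

lemma homotopic_through_quotient:
  fixes k :: "real \<times> 'p \<Rightarrow> 'w"
  assumes \<pi>: "quotient_map P Z \<pi>"
    and k: "continuous_map (prod_topology (top_of_set {0..1}) P) W k"
    and resp: "\<And>u p p'. \<lbrakk>u \<in> {0..1}; p \<in> topspace P; p' \<in> topspace P; \<pi> p = \<pi> p'\<rbrakk> \<Longrightarrow> k (u, p) = k (u, p')"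
    and k0: "\<And>p. p \<in> topspace P \<Longrightarrow> k (0, p) = f (\<pi> p)"
    and k1: "\<And>p. p \<in> topspace P \<Longrightarrow> k (1, p) = g (\<pi> p)"
  shows "homotopic_with (\<lambda>_. True) Z W f g"
proof -
  have Q: "quotient_map (prod_topology (top_of_set {0..1::real}) P)
     (prod_topology (top_of_set {0..1}) Z) (\<lambda>(u, p). (u, \<pi> p))"
    by (rule quotient_map_prod_right)
      (auto simp: \<pi> compact_imp_locally_compact_space compact_space_subtopology
        Hausdorff_space_subtopology)
  obtain h where h: "continuous_map (prod_topology (top_of_set {0..1}) Z) W h"
    "\<And>x. x \<in> topspace (prod_topology (top_of_set {0..1}) P) \<Longrightarrow> h ((\<lambda>(u, p). (u, \<pi> p)) x) = k x"
    by (rule quotient_map_lift_exists[OF Q k]) (auto intro: resp)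
  have Z: "topspace Z = \<pi> ` topspace P"
    using \<pi> by (simp add: quotient_imp_surjective_map)
  show ?thesis
    using h(1) h(2)[of "(0, _)"] h(2)[of "(1, _)"] k0 k1 by (subst homotopic_with) (auto simp: Z intro!: exI[of _ h])
qed

text \<open>Maps out of the suspension of a quotient of \<open>S\<close>, and below homotopies between them, may be
  given by formulas on \<open>S\<close>.\<close>

lemma suspension_map_lift:
  fixes k :: "'s \<times> real \<Rightarrow> 'w"
  assumes q: "quotient_map S X q"
    and k: "continuous_map (prod_topology S (top_of_set {0..1})) W k"
    and resp: "\<And>s s' t. \<lbrakk>s \<in> topspace S; s' \<in> topspace S; t \<in> {0..1};
        q s = q s' \<or> t = 0 \<or> t = 1\<rbrakk> \<Longrightarrow> k (s, t) = k (s', t)"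
  shows "\<exists>g. continuous_map (suspension X) W g \<and>
    (\<forall>s\<in>topspace S. \<forall>t\<in>{0..1}. g (sus X (q s) t) = k (s, t))"
proof -
  let ?P = "prod_topology S (top_of_set {0..1::real})"
  have qX: "q s \<in> topspace X" if "s \<in> topspace S" for s
    using q that by (auto simp: quotient_map_def)
  obtain g where "continuous_map (suspension X) W g"
    and "g ` topspace (suspension X) = k ` topspace ?P"
    and g: "\<And>p. p \<in> topspace ?P \<Longrightarrow> g ((\<lambda>(s, t). sus X (q s) t) p) = k p"
  proof (rule quotient_map_lift_exists[OF quotient_map_sus_compose[OF q] k], goal_cases)
    case (1 p p')
    then have *: "p \<in> topspace ?P" "p' \<in> topspace ?P"
      "(\<lambda>(s, t). sus X (q s) t) p = (\<lambda>(s, t). sus X (q s) t) p'"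
      by auto
    obtain s t s' t' where p: "p = (s, t)" "p' = (s', t')" by (metis surj_pair)
    show "k p = k p'"
      using * qX sus_eq_iff[of "q s" X "q s'" t t'] resp[of s s' t] unfolding p by auto
  qed blast
  then show ?thesis by (intro exI[of _ g]) force
qed

lemma homotopic_suspension_through_quotient:
  fixes k :: "real \<times> ('s \<times> real) \<Rightarrow> 'w"
  assumes q: "quotient_map S X q"
    and k: "continuous_map (prod_topology (top_of_set {0..1}) (prod_topology S (top_of_set {0..1}))) W k"
    and resp: "\<And>u s s' t. \<lbrakk>u \<in> {0..1}; s \<in> topspace S; s' \<in> topspace S; t \<in> {0..1};
        q s = q s' \<or> t = 0 \<or> t = 1\<rbrakk> \<Longrightarrow> k (u, (s, t)) = k (u, (s', t))"
    and k0: "\<And>s t. \<lbrakk>s \<in> topspace S; t \<in> {0..1}\<rbrakk> \<Longrightarrow> k (0, (s, t)) = f (sus X (q s) t)"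
  shows "\<exists>g. (\<forall>s\<in>topspace S. \<forall>t\<in>{0..1}. g (sus X (q s) t) = k (1, (s, t))) \<and>
    homotopic_with (\<lambda>_. True) (suspension X) W f g"
proof -
  let ?P = "prod_topology S (top_of_set {0..1::real})"
  have qX: "q s \<in> topspace X" if "s \<in> topspace S" for s
    using q that by (auto simp: quotient_map_def)
  have "continuous_map ?P (prod_topology (top_of_set {0..1::real}) ?P) (\<lambda>p. (1, p))"
    by (simp add: continuous_map_pairwise o_def)
  from continuous_map_compose[OF this k] have k1: "continuous_map ?P W (\<lambda>p. k (1, p))"
    by (simp add: o_def)
  obtain g where
      g: "\<And>s t. s \<in> topspace S \<Longrightarrow> t \<in> {0..1} \<Longrightarrow> g (sus X (q s) t) = k (1, (s, t))"
  proof -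
    have "k (1, (s, t)) = k (1, (s', t))" if "s \<in> topspace S" "s' \<in> topspace S" "t \<in> {0..1}"
      "q s = q s' \<or> t = 0 \<or> t = 1" for s s' t
      using resp[of 1 s s' t] that by simp
    from suspension_map_lift[OF q k1 this] that show ?thesis by blast
  qed
  have "homotopic_with (\<lambda>_. True) (suspension X) W f g"
  proof (rule homotopic_through_quotient[OF quotient_map_sus_compose[OF q] k])
    fix u :: real and p p' assume *: "u \<in> {0..1}" "p \<in> topspace ?P" "p' \<in> topspace ?P"
      "(\<lambda>(s, t). sus X (q s) t) p = (\<lambda>(s, t). sus X (q s) t) p'"
    obtain s t s' t' where p: "p = (s, t)" "p' = (s', t')" by (metis surj_pair)
    show "k (u, p) = k (u, p')"
      using * qX sus_eq_iff[of "q s" X "q s'" t t'] resp[of u s s' t] unfolding p by auto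
  qed (use g k0 in auto)
  with g show ?thesis by blast
qed

lemma homeomorphic_imp_suspension_homotopy_equivalent:
  assumes "X homeomorphic_space Y"
  shows "suspension X homotopy_equivalent_space suspension Y"
proof -
  obtain f g where f: "continuous_map X Y f" and g: "continuous_map Y X g"
    and gf: "\<And>x. x \<in> topspace X \<Longrightarrow> g (f x) = x" and fg: "\<And>y. y \<in> topspace Y \<Longrightarrow> f (g y) = y"
    using assms unfolding homeomorphic_space_def homeomorphic_maps_def by auto
  have lift: "\<exists>h. continuous_map (suspension X) (suspension Y) h \<and>
      (\<forall>x\<in>topspace X. \<forall>t\<in>{0..1}. h (sus X x t) = sus Y (f x) t)"
    if f: "continuous_map X Y f"
    for f and X :: "'x topology" and Y :: "'y topology"
  proof -
    have fY: "f x \<in> topspace Y" if "x \<in> topspace X" for x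
      using f that by (auto simp: continuous_map_def)
    let ?P = "prod_topology X (top_of_set {0..1::real})"
    have "continuous_map ?P (suspension Y) (\<lambda>(x, t). sus Y (f x) t)"
      unfolding case_prod_unfold
      by (intro continuous_intros continuous_map_compose[OF continuous_map_fst f, unfolded o_def]
          continuous_map_into_fulltopology[OF continuous_map_snd])
    moreover have "quotient_map X X (\<lambda>x. x)"
      by (simp add: quotient_map_def Collect_conj_eq Int_absorb1)
    ultimately have "\<exists>h. continuous_map (suspension X) (suspension Y) h \<and>
        (\<forall>x\<in>topspace X. \<forall>t\<in>{0..1}. h (sus X x t) = (\<lambda>(x, t). sus Y (f x) t) (x, t))"
    proof (intro suspension_map_lift)
      fix x x' and t :: real assume *: "x \<in> topspace X" "x' \<in> topspace X" "x = x' \<or> t = 0 \<or> t = 1"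
      show "(\<lambda>(x, t). sus Y (f x) t) (x, t) = (\<lambda>(x, t). sus Y (f x) t) (x', t)"
        using * fY sus_low[of "f x" Y "f x'" 0 0] sus_high[of "f x" Y "f x'" 1 1]
        by (elim disjE) simp_all
    qed
    then show ?thesis
      by simp
  qed
  obtain h where h: "continuous_map (suspension X) (suspension Y) h"
      "\<And>x t. x \<in> topspace X \<Longrightarrow> t \<in> {0..1} \<Longrightarrow> h (sus X x t) = sus Y (f x) t"
    using lift[OF f] by blast
  obtain k where k: "continuous_map (suspension Y) (suspension X) k"
      "\<And>x t. x \<in> topspace Y \<Longrightarrow> t \<in> {0..1} \<Longrightarrow> k (sus Y x t) = sus X (g x) t"
    using lift[OF g] by blast
  have fX: "f x \<in> topspace Y" if "x \<in> topspace X" for x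
    using f that by (auto simp: continuous_map_def)
  have gY: "g x \<in> topspace X" if "x \<in> topspace Y" for x
    using g that by (auto simp: continuous_map_def)
  have "homeomorphic_maps (suspension X) (suspension Y) h k"
    unfolding homeomorphic_maps_def
    by (intro conjI h(1) k(1)) (auto simp: topspace_suspension h(2) k(2) fX gY gf fg simp del: atLeastAtMost_iff)
  then show ?thesis
    by (intro homeomorphic_imp_homotopy_equivalent_space) (auto simp: homeomorphic_space_def)
qed


section \<open>Two quotients of one space with homotopy equivalent suspensions\<close>

text \<open>Up the meridian of \<open>a\<close>, then from the top pole down the meridian of \<open>b\<close> to height \<open>1 - l\<close>, and
  back to the top pole along the meridian of \<open>c\<close>. For this to be continuous at \<open>t = 2/3\<close>, one
  needs \<open>b = c\<close> unless \<open>l = 1\<close>.\<close>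

definition zigzag :: "'a topology \<Rightarrow> 'a \<Rightarrow> 'a \<Rightarrow> 'a \<Rightarrow> real \<Rightarrow> real \<Rightarrow> ('a \<times> real) set" where
  "zigzag Y a b c l t =
     (if t \<le> 1/3 then sus Y a (3 * t)
      else if t \<le> 2/3 then sus Y b (1 - l * (3 * t - 1))
      else sus Y c (1 - l * (3 - 3 * t)))"

text \<open>The map of suspensions that replaces the meridian of each point of \<open>X\<close> by a zigzag in the
  suspension of \<open>Y\<close>. Here \<open>e \<circ> e'\<close> is a retraction of \<open>Y\<close>.\<close>

definition is_transfer ::
    "'s topology \<Rightarrow> 'a topology \<Rightarrow> 'b topology \<Rightarrow> ('s \<Rightarrow> 'a) \<Rightarrow> ('s \<Rightarrow> 'b) \<Rightarrow> ('a \<Rightarrow> 'b) \<Rightarrow> ('b \<Rightarrow> 'a) \<Rightarrow>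
     ('s \<Rightarrow> real) \<Rightarrow> ('s \<Rightarrow> 's) \<Rightarrow> (('a \<times> real) set \<Rightarrow> ('b \<times> real) set) \<Rightarrow> bool" where
  "is_transfer S X Y q q' e e' lam m F \<longleftrightarrow> continuous_map (suspension X) (suspension Y) F \<and>
     (\<forall>s\<in>topspace S. \<forall>t\<in>{0..1}. F (sus X (q s) t) =
        zigzag Y (e (q s)) (e (e' (q' (m s)))) (q' (m s)) (lam s) t)"

text \<open>Two quotients \<open>X\<close> and \<open>Y\<close> of a space \<open>S\<close> have retracts \<open>e' ` Y\<close> and \<open>e ` X\<close>, which \<open>e\<close> and \<open>e'\<close>
  identify with each other (the common retract \<open>A\<close>). The quotient maps are injective away from the zeros
  of \<open>lam\<close>, and \<open>lam\<close> vanishes over \<open>A\<close>; so \<open>X\<close> and \<open>Y\<close> agree where \<open>lam\<close> is nonzero. The homotopy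
  \<open>H\<close> descends to both quotients, and at time \<open>1\<close> it has moved the set \<open>lam < 1\<close>, a neighbourhood of
  the part over \<open>A\<close>, into \<open>A\<close>.\<close>

locale common_quotients =
  fixes S :: "'s topology" and X :: "'a topology" and Y :: "'b topology"
    and q :: "'s \<Rightarrow> 'a" and q' :: "'s \<Rightarrow> 'b" and e :: "'a \<Rightarrow> 'b" and e' :: "'b \<Rightarrow> 'a"
    and lam :: "'s \<Rightarrow> real" and H :: "real \<Rightarrow> 's \<Rightarrow> 's"
  assumes quot: "quotient_map S X q" and quot': "quotient_map S Y q'"
    and cont_e: "continuous_map X Y e" and cont_e': "continuous_map Y X e'"
    and e_e'_e: "x \<in> topspace X \<Longrightarrow> e (e' (e x)) = e x"
    and e'_e_e': "y \<in> topspace Y \<Longrightarrow> e' (e (e' y)) = e' y"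
    and cont_lam: "continuous_map S euclideanreal lam"
    and lam_range: "s \<in> topspace S \<Longrightarrow> 0 \<le> lam s \<and> lam s \<le> 1"
    and cont_H: "continuous_map (prod_topology (top_of_set {0..1}) S) S (\<lambda>(t, s). H t s)"
    and H_0: "s \<in> topspace S \<Longrightarrow> H 0 s = s"
    and fibre: "\<lbrakk>s \<in> topspace S; s' \<in> topspace S; q s = q s'\<rbrakk> \<Longrightarrow> s = s' \<or> lam s = 0 \<and> lam s' = 0"
    and fibre': "\<lbrakk>s \<in> topspace S; s' \<in> topspace S; q' s = q' s'\<rbrakk> \<Longrightarrow> s = s' \<or> lam s = 0 \<and> lam s' = 0"
    and lam_zero: "\<lbrakk>s \<in> topspace S; y \<in> topspace Y; q s = e' y\<rbrakk> \<Longrightarrow> lam s = 0"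
    and lam_zero': "\<lbrakk>s \<in> topspace S; x \<in> topspace X; q' s = e x\<rbrakk> \<Longrightarrow> lam s = 0"
    and near: "\<lbrakk>s \<in> topspace S; lam s < 1\<rbrakk> \<Longrightarrow> q (H 1 s) \<in> e' ` topspace Y"
    and near': "\<lbrakk>s \<in> topspace S; lam s < 1\<rbrakk> \<Longrightarrow> q' (H 1 s) \<in> e ` topspace X"
    and H_fibre: "\<lbrakk>s \<in> topspace S; s' \<in> topspace S; q s = q s'; t \<in> {0..1}\<rbrakk> \<Longrightarrow> q (H t s) = q (H t s')"
    and H_fibre': "\<lbrakk>s \<in> topspace S; s' \<in> topspace S; q' s = q' s'; t \<in> {0..1}\<rbrakk> \<Longrightarrow> q' (H t s) = q' (H t s')"
begin

lemma q_in: "s \<in> topspace S \<Longrightarrow> q s \<in> topspace X"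
  and q'_in: "s \<in> topspace S \<Longrightarrow> q' s \<in> topspace Y"
  using quot quot' by (auto simp: quotient_map_def)

lemma q_surj: "x \<in> topspace X \<Longrightarrow> \<exists>s\<in>topspace S. x = q s"
  and q'_surj: "y \<in> topspace Y \<Longrightarrow> \<exists>s\<in>topspace S. y = q' s"
  using quotient_imp_surjective_map[OF quot] quotient_imp_surjective_map[OF quot'] by blast+

lemma e_in: "x \<in> topspace X \<Longrightarrow> e x \<in> topspace Y"
  and e'_in: "y \<in> topspace Y \<Longrightarrow> e' y \<in> topspace X"
  using cont_e cont_e' by (auto simp: continuous_map_def)

lemma H_in: "\<lbrakk>s \<in> topspace S; t \<in> {0..1}\<rbrakk> \<Longrightarrow> H t s \<in> topspace S"
  using continuous_map_image_subset_topspace[OF cont_H] by force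

lemma H1_in: "s \<in> topspace S \<Longrightarrow> H 1 s \<in> topspace S"
  using H_in by simp

lemmas in_simps = q_in q'_in e_in e'_in H_in H1_in

lemma near_fixed: "\<lbrakk>s \<in> topspace S; lam s < 1\<rbrakk> \<Longrightarrow> e' (e (q (H 1 s))) = q (H 1 s)"
  using near e'_e_e' by fastforce

lemma near_fixed': "\<lbrakk>s \<in> topspace S; lam s < 1\<rbrakk> \<Longrightarrow> e (e' (q' (H 1 s))) = q' (H 1 s)"
  using near' e_e'_e by fastforce

lemma fibre_cases:
  assumes "s \<in> topspace S" "s' \<in> topspace S" "q s = q s'"
  obtains "s = s'" | "lam s = 0" "lam s' = 0"
  using fibre[OF assms] by blast

lemma cont_q: "continuous_map S X q" and cont_q': "continuous_map S Y q'"
  using quot quot' by (auto intro: quotient_imp_continuous_map)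

lemma continuous_map_q: "continuous_map T S f \<Longrightarrow> continuous_map T X (\<lambda>p. q (f p))"
  and continuous_map_q': "continuous_map T S f \<Longrightarrow> continuous_map T Y (\<lambda>p. q' (f p))"
  and continuous_map_lam: "continuous_map T S f \<Longrightarrow> continuous_map T euclideanreal (\<lambda>p. lam (f p))"
  and continuous_map_e: "continuous_map T X g \<Longrightarrow> continuous_map T Y (\<lambda>p. e (g p))"
  and continuous_map_e': "continuous_map T Y h \<Longrightarrow> continuous_map T X (\<lambda>p. e' (h p))"
  using continuous_map_compose[OF _ cont_q] continuous_map_compose[OF _ cont_q']
    continuous_map_compose[OF _ cont_e] continuous_map_compose[OF _ cont_e']
    continuous_map_compose[OF _ cont_lam] by (auto simp: o_def)

lemma continuous_map_H:
  assumes "continuous_map T S f" "continuous_map T (top_of_set {0..1}) c"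
  shows "continuous_map T S (\<lambda>p. H (c p) (f p))"
proof -
  have "continuous_map T (prod_topology (top_of_set {0..1}) S) (\<lambda>p. (c p, f p))"
    using assms by (simp add: continuous_map_pairwise o_def)
  from continuous_map_compose[OF this cont_H] show ?thesis by (simp add: o_def)
qed

lemma continuous_map_H1: "continuous_map T S f \<Longrightarrow> continuous_map T S (\<lambda>p. H 1 (f p))"
  by (rule continuous_map_H) auto

lemmas cont_rules = continuous_intros continuous_map_q continuous_map_q' continuous_map_lam
  continuous_map_e continuous_map_e' continuous_map_H continuous_map_H1

lemma ex_transfer: "\<exists>F. is_transfer S X Y q q' e e' lam (H 1) F"
proof -
  let ?P = "prod_topology S (top_of_set {0..1::real})"
  have f: "continuous_map ?P S fst"
    by (rule continuous_map_fst)
  have s: "continuous_map ?P euclideanreal snd"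
    by (rule continuous_map_into_fulltopology[OF continuous_map_snd])
  have cont: "continuous_map ?P (suspension Y) (\<lambda>(s, t).
        zigzag Y (e (q s)) (e (e' (q' (H 1 s)))) (q' (H 1 s)) (lam s) t)"
    unfolding zigzag_def case_prod_unfold
  proof (rule continuous_map_three_cases)
    fix p assume p: "p \<in> topspace ?P"
    then have 1: "fst p \<in> topspace S" by auto
    show "sus Y (e (q (fst p))) (3 * snd p) =
        sus Y (e (e' (q' (H 1 (fst p))))) (1 - lam (fst p) * (3 * snd p - 1))" if "snd p = 1/3"
      unfolding that by (intro sus_high) (use 1 in \<open>auto simp: in_simps\<close>)
    show "sus Y (e (e' (q' (H 1 (fst p))))) (1 - lam (fst p) * (3 * snd p - 1)) =
        sus Y (q' (H 1 (fst p))) (1 - lam (fst p) * (3 - 3 * snd p))" if "snd p = 2/3"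
    proof (cases "lam (fst p) < 1")
      case True with 1 near_fixed' show ?thesis unfolding that by simp
    next
      case False
      then have "lam (fst p) = 1" using lam_range[OF 1] by simp
      then show ?thesis using 1 unfolding that by (intro sus_low) (auto simp: in_simps)
    qed
  qed (intro cont_rules f s | simp)+
  have "\<exists>F. continuous_map (suspension X) (suspension Y) F \<and>
     (\<forall>s\<in>topspace S. \<forall>t\<in>{0..1}. F (sus X (q s) t) =
       (\<lambda>(s, t). zigzag Y (e (q s)) (e (e' (q' (H 1 s)))) (q' (H 1 s)) (lam s) t) (s, t))"
  proof (rule suspension_map_lift[OF quot cont])
    fix s s' and t :: real
    assume *: "s \<in> topspace S" "s' \<in> topspace S" "t \<in> {0..1}" "q s = q s' \<or> t = 0 \<or> t = 1"
    consider "t = 0" | "t = 1" | "q s = q s'" "t > 0" "t < 1"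
      using * by force
    then have "zigzag Y (e (q s)) (e (e' (q' (H 1 s)))) (q' (H 1 s)) (lam s) t =
        zigzag Y (e (q s')) (e (e' (q' (H 1 s')))) (q' (H 1 s')) (lam s') t"
    proof cases
      case 1 then show ?thesis
        using * by (auto simp: zigzag_def in_simps intro!: sus_low del: equalityI)
    next
      case 2 then show ?thesis
        using * by (auto simp: zigzag_def in_simps intro!: sus_high del: equalityI)
    next
      case 3
      from *(1,2) 3(1) show ?thesis
      proof (cases rule: fibre_cases)
        case 2
        then show ?thesis
          using * 3(1) by (auto simp: zigzag_def in_simps intro!: sus_high del: equalityI)
      qed auto
    qed
    then show "(\<lambda>(s, t). zigzag Y (e (q s)) (e (e' (q' (H 1 s)))) (q' (H 1 s)) (lam s) t) (s, t) =
        (\<lambda>(s, t). zigzag Y (e (q s)) (e (e' (q' (H 1 s)))) (q' (H 1 s)) (lam s) t) (s', t)"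
      by simp
  qed
  then show ?thesis
    unfolding is_transfer_def by simp
qed

lemma swapped: "common_quotients S Y X q' q e' e lam H"
  by (rule common_quotients.intro)
    (fact quot quot' cont_e cont_e' e_e'_e e'_e_e' cont_lam lam_range cont_H H_0 fibre fibre'
      lam_zero lam_zero' near near' H_fibre H_fibre')+

text \<open>On the lower third of each meridian, and over the common retract on the whole meridian, a transfer
  only depends on the retraction. This lets paths cancel below.\<close>

lemma transfer_back_low:
  assumes "is_transfer S Y X q' q e' e lam (H 1) G" "y \<in> topspace Y" "t \<le> 1/3"
  shows "G (sus Y y t) = sus X (e' y) (3 * t)"
proof -
  obtain s where s: "s \<in> topspace S" "y = q' s"
    using q'_surj assms(2) by blast
  have "G (sus Y y (max 0 t)) = sus X (e' y) (3 * max 0 t)"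
    using assms(1,3) s by (simp add: is_transfer_def zigzag_def max_def)
  moreover have "sus Y y (max 0 t) = sus Y y t" "sus X (e' y) (3 * max 0 t) = sus X (e' y) (3 * t)"
    by (auto intro!: sus_clamp del: equalityI)
  ultimately show ?thesis by simp
qed

lemma transfer_back_retract:
  assumes "is_transfer S Y X q' q e' e lam (H 1) G" "x \<in> topspace X"
  shows "G (sus Y (e x) t) = sus X (e' (e x)) (3 * t)"
proof (cases "t \<le> 1/3")
  case True
  then show ?thesis using assms by (simp add: transfer_back_low e_in)
next
  case False
  obtain s where s: "s \<in> topspace S" "e x = q' s"
    using q'_surj e_in assms(2) by metis
  then have "lam s = 0" using lam_zero' assms(2) by metis
  then have "G (sus Y (e x) (min 1 t)) = sus X (e' (e x)) (3 * min 1 t)"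
    using assms False s
    by (auto simp: is_transfer_def zigzag_def in_simps min_def intro!: sus_high del: equalityI)
  moreover have "sus Y (e x) (min 1 t) = sus Y (e x) t"
      "sus X (e' (e x)) (3 * min 1 t) = sus X (e' (e x)) (3 * t)"
    using False by (auto intro!: sus_clamp del: equalityI)
  ultimately show ?thesis by simp
qed

text \<open>The heart of the argument: the unwanted meridians cancel in the composite. The heights at which
  paths turn must keep respecting the identifications over \<open>A\<close> all the time.\<close>

lemma transfer_back_forth:
  assumes F: "is_transfer S X Y q q' e e' lam (H 1) F"
    and G: "is_transfer S Y X q' q e' e lam (H 1) G"
  shows "homotopic_with (\<lambda>_. True) (suspension X) (suspension X) (G \<circ> F) id"
proof -
  let ?I = "top_of_set {0..1::real}"
  let ?P = "prod_topology ?I (prod_topology S ?I)"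
  have cont_G: "continuous_map (suspension Y) (suspension X) G"
    using G by (simp add: is_transfer_def)
  have cG: "continuous_map T (suspension X) (\<lambda>p. G (h p))" if "continuous_map T (suspension Y) h" for T h
    using continuous_map_compose[OF that cont_G] by (simp add: o_def)
  have cu': "continuous_map ?P ?I fst" and cs: "continuous_map ?P S (\<lambda>p. fst (snd p))"
    and ct': "continuous_map ?P ?I (\<lambda>p. snd (snd p))"
    using continuous_map_compose[OF continuous_map_snd continuous_map_fst, of ?I S ?I]
      continuous_map_compose[OF continuous_map_snd continuous_map_snd, of ?I S ?I]
    by (auto simp: o_def continuous_map_fst)
  have cu: "continuous_map ?P euclideanreal fst" and ct: "continuous_map ?P euclideanreal (\<lambda>p. snd (snd p))"
    using cu' ct' by (auto intro: continuous_map_into_fulltopology)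
  have cu'': "continuous_map ?P ?I (\<lambda>p. 1 - fst p)"
    by (intro continuous_map_into_subtopology continuous_intros cu) auto
  have top: "p \<in> topspace ?P \<longleftrightarrow>
      fst p \<in> {0..1} \<and> fst (snd p) \<in> topspace S \<and> snd (snd p) \<in> {0..1}" for p
    by (cases p) auto
  \<comment> \<open>\<open>K\<close> raises the turning height of the inner path to at least \<open>1/3\<close>. The path down and the path up
      agree below \<open>1/3\<close>, so this cancels the common part. At the same time \<open>H\<close> moves the first meridian.\<close>
  define K where "K = (\<lambda>p. let u = fst p; s = fst (snd p); t = snd (snd p) in
     if t \<le> 1/3 then G (sus Y (e (q (H u (H u s)))) (3 * t))
     else if t \<le> 2/3 then G (sus Y (e (e' (q' (H 1 s)))) (max (1 - lam s * (3 * t - 1)) (u/3)))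
     else G (sus Y (q' (H 1 s)) (max (1 - lam s * (3 - 3 * t)) (u/3))))"
  define M where "M = (\<lambda>s. H 1 (H 1 s))"
  define \<mu> where "\<mu> = (\<lambda>s. lam (H 1 s))"
  \<comment> \<open>The point \<open>q (M s)\<close> and its retract are equal unless \<open>\<mu> s = 1\<close>. \<open>L\<close> straightens the motion along the
      meridian of the retract, up and then down to height \<open>1 - \<mu>\<close>, into a motion straight to that height.\<close>
  define L where "L = (\<lambda>p. let u = fst p; s = fst (snd p); t = snd (snd p) in
     if t \<le> 8/9 then sus X (e' (e (q (M s))))
       ((1 - u) * (min (9 * t) 1 - \<mu> s * max 0 (9 * t - 7)) + u * ((1 - \<mu> s) * (9 * t / 8)))
     else sus X (q (M s)) (1 - \<mu> s * (9 - 9 * t)))"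
  \<comment> \<open>If \<open>\<mu> s < 1\<close>, the whole path lies on the meridian of \<open>q (M s)\<close>; if \<open>\<mu> s = 1\<close>, its first part rests at the
      bottom pole. So it is a reparametrised meridian, and \<open>E\<close> undoes both this and \<open>H\<close>.\<close>
  define E where "E = (\<lambda>p. let u = fst p; s = fst (snd p); t = snd (snd p) in
     sus X (q (H (1 - u) (H (1 - u) s)))
       ((1 - u) * ((1 - \<mu> s) * min 1 (9 * t / 8) + \<mu> s * max 0 (9 * t - 8)) + u * t))"
  have \<mu>_range: "0 \<le> \<mu> s \<and> \<mu> s \<le> 1" if "s \<in> topspace S" for s
    using that by (simp add: \<mu>_def lam_range in_simps)
  have M_in: "M s \<in> topspace S" if "s \<in> topspace S" for s
    using that by (simp add: M_def in_simps)
  have M_fibre: "q (M s) = q (M s') \<and> \<mu> s = \<mu> s'"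
    if "s \<in> topspace S" "s' \<in> topspace S" "q s = q s'" for s s'
    using that H_fibre[of "H 1 s" "H 1 s'" 1] H_fibre[of s s' 1] fibre[of "H 1 s" "H 1 s'"]
    by (auto simp: M_def \<mu>_def in_simps)
  have M_fixed: "e' (e (q (M s))) = q (M s)" if "s \<in> topspace S" "\<mu> s < 1" for s
    using that near_fixed[of "H 1 s"] by (simp add: M_def \<mu>_def in_simps)

  have contK: "continuous_map ?P (suspension X) K"
    unfolding K_def Let_def
  proof (rule continuous_map_three_cases)
    fix p assume p: "p \<in> topspace ?P"
    then have 1: "fst (snd p) \<in> topspace S" "fst p \<in> {0..1}" by (auto simp: top)
    have "sus Y (e (q (H (fst p) (H (fst p) (fst (snd p)))))) (3 * (1/3)) =
        sus Y (e (e' (q' (H 1 (fst (snd p)))))) (max (1 - lam (fst (snd p)) * (3 * (1/3) - 1)) (fst p / 3))"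
      by (intro sus_high) (use 1 in \<open>auto simp: in_simps\<close>)
    then show "G (sus Y (e (q (H (fst p) (H (fst p) (fst (snd p)))))) (3 * snd (snd p))) =
        G (sus Y (e (e' (q' (H 1 (fst (snd p)))))) (max (1 - lam (fst (snd p)) * (3 * snd (snd p) - 1)) (fst p / 3)))"
      if "snd (snd p) = 1/3"
      unfolding that by simp
    show "G (sus Y (e (e' (q' (H 1 (fst (snd p)))))) (max (1 - lam (fst (snd p)) * (3 * snd (snd p) - 1)) (fst p / 3))) =
        G (sus Y (q' (H 1 (fst (snd p)))) (max (1 - lam (fst (snd p)) * (3 - 3 * snd (snd p))) (fst p / 3)))"
      if t: "snd (snd p) = 2/3"
    proof (cases "lam (fst (snd p)) < 1")
      case True with 1 near_fixed' show ?thesis unfolding t by simp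
    next
      case False
      then have "lam (fst (snd p)) = 1" using lam_range[OF 1(1)] by simp
      then show ?thesis
        using 1 unfolding t by (simp add: transfer_back_low[OF G] in_simps e'_e_e')
    qed
  qed (intro cont_rules cG cu cs cu' ct | simp)+
  have contL: "continuous_map ?P (suspension X) L"
    unfolding L_def Let_def M_def \<mu>_def
  proof (rule continuous_map_two_cases)
    fix p assume p: "p \<in> topspace ?P" "snd (snd p) = 8 / 9"
    let ?s = "fst (snd p)" and ?u = "fst p"
    have 1: "?s \<in> topspace S" using p by (auto simp: top)
    have 2: "(1 - ?u) * (min (9 * (8/9)) 1 - lam (H 1 ?s) * max 0 (9 * (8/9) - 7)) +
           ?u * ((1 - lam (H 1 ?s)) * (9 * (8/9) / 8)) = 1 - lam (H 1 ?s)"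
      by (simp add: algebra_simps)
    have "sus X (e' (e (q (M ?s)))) (1 - \<mu> ?s) = sus X (q (M ?s)) (1 - \<mu> ?s)"
    proof (cases "\<mu> ?s < 1")
      case True with M_fixed 1 show ?thesis by simp
    next
      case False
      then show ?thesis using 1 M_in by (intro sus_low) (auto simp: in_simps)
    qed
    then show "sus X (e' (e (q (H 1 (H 1 ?s)))))
          ((1 - ?u) * (min (9 * snd (snd p)) 1 - lam (H 1 ?s) * max 0 (9 * snd (snd p) - 7)) +
           ?u * ((1 - lam (H 1 ?s)) * (9 * snd (snd p) / 8))) =
         sus X (q (H 1 (H 1 ?s))) (1 - lam (H 1 ?s) * (9 - 9 * snd (snd p)))"
      unfolding p(2) 2 by (simp add: M_def \<mu>_def)
  qed (intro cont_rules cu cs ct | simp)+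
  have contE: "continuous_map ?P (suspension X) E"
    unfolding E_def Let_def M_def \<mu>_def
    by (intro cont_rules cu cs ct cu'' | simp)+

  have respK: "K (u, (s, t)) = K (u, (s', t))"
    if *: "u \<in> {0..1}" "s \<in> topspace S" "s' \<in> topspace S" "t \<in> {0..1}" "q s = q s' \<or> t = 0 \<or> t = 1"
    for u s s' t
  proof -
    have high: "G (sus Y y r) = G (sus Y y' r')" if "y \<in> topspace Y" "y' \<in> topspace Y" "1 \<le> r" "1 \<le> r'" for y y' r r'
      using sus_high[OF that] by simp
    have low: "G (sus Y y 0) = G (sus Y y' 0)" if "y \<in> topspace Y" "y' \<in> topspace Y" for y y'
      using sus_low[OF that, of 0 0] by simp
    have HH: "H u (H u s) \<in> topspace S" "H u (H u s') \<in> topspace S"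
      using * by (auto simp: in_simps)
    consider "t = 0" | "t = 1" | "q s = q s'" "t > 0" "t < 1"
      using * by force
    then show ?thesis
    proof cases
      case 1 then show ?thesis
        using * HH by (auto simp: K_def in_simps intro!: low del: equalityI)
    next
      case 2 then show ?thesis
        using * by (auto simp: K_def in_simps intro!: high del: equalityI)
    next
      case 3
      have eq: "q (H u (H u s)) = q (H u (H u s'))"
        using * 3 by (auto simp: in_simps intro!: H_fibre)
      from *(2,3) 3(1) show ?thesis
      proof (cases rule: fibre_cases)
        case 2
        then show ?thesis
          using * 3(1) eq by (auto simp: K_def in_simps intro!: high del: equalityI)
      qed auto
    qed
  qed
  have respL: "L (u, (s, t)) = L (u, (s', t))"
    if *: "u \<in> {0..1}" "s \<in> topspace S" "s' \<in> topspace S" "t \<in> {0..1}" "q s = q s' \<or> t = 0 \<or> t = 1"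
    for u s s' t
  proof -
    consider "t = 0" | "t = 1" | "q s = q s'"
      using * by force
    then show ?thesis
    proof cases
      case 1 then show ?thesis
        using * M_in sus_low[of "e' (e (q (M s)))" X "e' (e (q (M s')))" 0 0] by (simp add: L_def in_simps)
    next
      case 2 then show ?thesis
        using * M_in sus_high[of "q (M s)" X "q (M s')" 1 1] by (simp add: L_def in_simps)
    next
      case 3 then show ?thesis
        using * M_fibre[of s s'] by (simp add: L_def)
    qed
  qed
  have respE: "E (u, (s, t)) = E (u, (s', t))"
    if *: "u \<in> {0..1}" "s \<in> topspace S" "s' \<in> topspace S" "t \<in> {0..1}" "q s = q s' \<or> t = 0 \<or> t = 1"
    for u s s' t
  proof -
    have HH: "H (1 - u) (H (1 - u) s) \<in> topspace S" "H (1 - u) (H (1 - u) s') \<in> topspace S"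
      using * by (auto simp: in_simps)
    consider "t = 0" | "t = 1" | "q s = q s'"
      using * by force
    then show ?thesis
    proof cases
      case 1 then show ?thesis
        using sus_low[OF q_in[OF HH(1)] q_in[OF HH(2)], of 0 0] by (simp add: E_def)
    next
      case 2 then show ?thesis
        using sus_high[OF q_in[OF HH(1)] q_in[OF HH(2)], of 1 1] by (simp add: E_def)
    next
      case 3
      have eq: "q (H (1 - u) (H (1 - u) s)) = q (H (1 - u) (H (1 - u) s'))"
        using * 3 by (auto simp: in_simps intro!: H_fibre)
      show ?thesis
        using eq M_fibre[of s s'] * 3 by (simp add: E_def)
    qed
  qed

  have K0: "K (0, (s, t)) = (G \<circ> F) (sus X (q s) t)" if "s \<in> topspace S" "t \<in> {0..1}" for s t
  proof -
    have "sus Y y (max r 0) = sus Y y r" for y r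
      by (rule sus_clamp) auto
    then show ?thesis
      using that F by (simp add: K_def is_transfer_def zigzag_def H_0)
  qed
  have L0: "L (0, (s, t)) = K (1, (s, t))" if s: "s \<in> topspace S" and t: "t \<in> {0..1}" for s t
  proof -
    have top1: "sus X x r = sus X x' r'" if "x \<in> topspace X" "x' \<in> topspace X" "r \<ge> 1" "r' \<ge> 1" for x x' r r'
      using that by (rule sus_high)
    have third: "1 \<le> 3 * max r (1/3)" for r :: real
      by (simp add: max_def)
    have K1: "K (1, (s, t)) = (if t \<le> 7/9 then sus X (e' (e (q (M s)))) (9 * t)
        else G (sus Y (q' (H 1 s)) (3 * t - 2)))"
    proof -
      consider "t \<le> 1/3" | "1/3 < t" "t \<le> 2/3" | "2/3 < t" "t \<le> 7/9" | "7/9 < t" by linarith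
      then show ?thesis
      proof cases
        case 1
        then show ?thesis
          using s M_in by (simp add: K_def transfer_back_retract[OF G] in_simps M_def)
      next
        case 2
        then show ?thesis
          using s M_in
          by (auto simp: K_def transfer_back_retract[OF G] in_simps third intro!: sus_high del: equalityI)
      next
        case 3
        show ?thesis
        proof (cases "lam s < 1")
          case True
          then obtain x where "x \<in> topspace X" "q' (H 1 s) = e x" using near' s by blast
          then show ?thesis
            using s 3 M_in by (auto simp: K_def transfer_back_retract[OF G] in_simps third intro!: sus_high del: equalityI)
        next
          case False
          then have "lam s = 1" using lam_range[OF s] by simp
          then have m: "max (1 - lam s * (3 - 3 * t)) (1 / 3) = 1/3" using 3 by (simp add: max_def)
          have "K (1, (s, t)) = G (sus Y (q' (H 1 s)) (max (1 - lam s * (3 - 3 * t)) (1/3)))"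
            using 3 by (simp add: K_def)
          also have "\<dots> = sus X (e' (q' (H 1 s))) (3 * (1/3))"
            unfolding m by (rule transfer_back_low[OF G]) (use s in \<open>auto simp: in_simps\<close>)
          also have "\<dots> = sus X (e' (e (q (M s)))) (9 * t)"
            by (rule sus_high) (use s 3 M_in in \<open>auto simp: in_simps\<close>)
          finally show ?thesis using 3 by simp
        qed
      next
        case 4
        show ?thesis
        proof (cases "lam s < 1")
          case True
          then obtain x where "x \<in> topspace X" "q' (H 1 s) = e x" using near' s by blast
          then show ?thesis
            using s 4 M_in by (auto simp: K_def transfer_back_retract[OF G] in_simps third intro!: sus_high del: equalityI)
        next
          case False
          then have "lam s = 1" using lam_range[OF s] by simp
          then have "max (1 - lam s * (3 - 3 * t)) (1 / 3) = 3 * t - 2" using 4 by (simp add: max_def)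
          then show ?thesis
            using s 4 by (simp add: K_def in_simps)
        qed
      qed
    qed
    show ?thesis
    proof (cases "t \<le> 7/9")
      case True
      then show ?thesis
        unfolding K1 by (auto simp: L_def intro!: sus_clamp del: equalityI)
    next
      case False
      have "G (sus Y (q' (H 1 s)) (3 * t - 2)) =
          zigzag X (e' (q' (H 1 s))) (e' (e (q (M s)))) (q (M s)) (\<mu> s) (3 * t - 2)"
        using G s t False by (simp add: is_transfer_def M_def \<mu>_def in_simps)
      then show ?thesis
        using False t unfolding K1 by (auto simp: L_def zigzag_def algebra_simps min_def max_def)
    qed
  qed
  have E0: "E (0, (s, t)) = L (1, (s, t))" if s: "s \<in> topspace S" and t: "t \<in> {0..1}" for s t
  proof (cases "t \<le> 8/9")
    case True
    have "sus X (q (M s)) ((1 - \<mu> s) * (9 * t / 8)) = sus X (e' (e (q (M s)))) ((1 - \<mu> s) * (9 * t / 8))"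
    proof (cases "\<mu> s < 1")
      case True with M_fixed s show ?thesis by simp
    next
      case False
      then have "\<mu> s = 1" using \<mu>_range[OF s] by simp
      then show ?thesis using s M_in by (intro sus_low) (auto simp: in_simps)
    qed
    then have "sus X (q (H 1 (H 1 s))) ((1 - \<mu> s) * (9 * t / 8)) = sus X (e' (e (q (M s)))) ((1 - \<mu> s) * (9 * t / 8))"
      by (simp only: M_def)
    then show ?thesis
      using True by (simp add: E_def L_def)
  next
    case False
    then have "(1 - \<mu> s) * min 1 (9 * t / 8) + \<mu> s * max 0 (9 * t - 8) = 1 - \<mu> s * (9 - 9 * t)"
      by (simp add: min_def max_def algebra_simps)
    moreover have "E (0, (s, t)) =
        sus X (q (M s)) ((1 - \<mu> s) * min 1 (9 * t / 8) + \<mu> s * max 0 (9 * t - 8))"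
      by (simp add: E_def M_def)
    moreover have "L (1, (s, t)) = sus X (q (M s)) (1 - \<mu> s * (9 - 9 * t))"
      using False by (simp add: L_def)
    ultimately show ?thesis by simp
  qed
  obtain g1 where g1: "\<And>s t. s \<in> topspace S \<Longrightarrow> t \<in> {0..1} \<Longrightarrow> g1 (sus X (q s) t) = K (1, (s, t))"
      "homotopic_with (\<lambda>_. True) (suspension X) (suspension X) (G \<circ> F) g1"
    using homotopic_suspension_through_quotient[OF quot contK respK K0] by blast
  have L0': "L (0, (s, t)) = g1 (sus X (q s) t)" if "s \<in> topspace S" "t \<in> {0..1}" for s t
    using L0 g1(1) that by simp
  obtain g2 where g2: "\<And>s t. s \<in> topspace S \<Longrightarrow> t \<in> {0..1} \<Longrightarrow> g2 (sus X (q s) t) = L (1, (s, t))"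
      "homotopic_with (\<lambda>_. True) (suspension X) (suspension X) g1 g2"
    using homotopic_suspension_through_quotient[OF quot contL respL L0'] by blast
  have E0': "E (0, (s, t)) = g2 (sus X (q s) t)" if "s \<in> topspace S" "t \<in> {0..1}" for s t
    using E0 g2(1) that by simp
  obtain g3 where g3: "\<And>s t. s \<in> topspace S \<Longrightarrow> t \<in> {0..1} \<Longrightarrow> g3 (sus X (q s) t) = E (1, (s, t))"
      "homotopic_with (\<lambda>_. True) (suspension X) (suspension X) g2 g3"
    using homotopic_suspension_through_quotient[OF quot contE respE E0'] by blast
  have "g3 w = id w" if w: "w \<in> topspace (suspension X)" for w
  proof -
    obtain x t where "x \<in> topspace X" "t \<in> {0..1}" "w = sus X x t"
      using w by (auto simp: topspace_suspension)
    moreover obtain s where "s \<in> topspace S" "x = q s"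
      using q_surj calculation(1) by blast
    ultimately show ?thesis
      using g3(1) by (simp add: E_def H_0)
  qed
  then have "homotopic_with (\<lambda>_. True) (suspension X) (suspension X) g3 id"
    using g3(2) by (intro homotopic_with_equal) (auto dest: homotopic_with_imp_continuous_maps)
  then show ?thesis
    using g1(2) g2(2) g3(2) homotopic_with_trans by blast
qed

theorem suspension_homotopy_equivalent: "suspension X homotopy_equivalent_space suspension Y"
proof -
  interpret swap: common_quotients S Y X q' q e' e lam H
    by (rule swapped)
  obtain F where F: "is_transfer S X Y q q' e e' lam (H 1) F"
    using ex_transfer by blast
  obtain G where G: "is_transfer S Y X q' q e' e lam (H 1) G"
    using swap.ex_transfer by blast
  show ?thesis
    unfolding homotopy_equivalent_space_def
    using F G transfer_back_forth[OF F G] swap.transfer_back_forth[OF G F]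
    by (auto simp: is_transfer_def)
qed

end


section \<open>SU(2) as the unit quaternions\<close>

text \<open>The quaternion \<open>a + v\<close> with real part \<open>a\<close> and imaginary part \<open>v\<close> is the matrix \<open>quat a v\<close>; the
  functions \<open>re_part\<close> and \<open>im_part\<close> read off its parts from the first row.\<close>

definition re_part :: "complex^2^2 \<Rightarrow> real" where
  "re_part A = Re (A $ 1 $ 1)"

definition im_part :: "complex^2^2 \<Rightarrow> real^3" where
  "im_part A = vector [Im (A $ 1 $ 1), Re (A $ 1 $ 2), Im (A $ 1 $ 2)]"

definition quat :: "real \<Rightarrow> real^3 \<Rightarrow> complex^2^2" where
  "quat a v = vector [vector [Complex a (v $ 1), Complex (v $ 2) (v $ 3)],
                      vector [Complex (- v $ 2) (v $ 3), Complex a (- v $ 1)]]"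

lemma quat_entries [simp]:
  "quat a v $ 1 $ 1 = Complex a (v $ 1)" "quat a v $ 1 $ 2 = Complex (v $ 2) (v $ 3)"
  "quat a v $ 2 $ 1 = Complex (- v $ 2) (v $ 3)" "quat a v $ 2 $ 2 = Complex a (- v $ 1)"
  by (simp_all add: quat_def)

lemma re_part_quat [simp]: "re_part (quat a v) = a"
  by (simp add: re_part_def)

lemma im_part_quat [simp]: "im_part (quat a v) = v"
  by (simp add: im_part_def vec_eq_iff forall_3)

lemma quat_one: "quat 1 0 = mat 1"
  by (simp add: vec_eq_iff forall_2 mat_def complex_eq_iff)

lemma norm_real3: "(norm (v :: real^3))\<^sup>2 = (v $ 1)\<^sup>2 + (v $ 2)\<^sup>2 + (v $ 3)\<^sup>2"
  by (simp add: norm_vec_def L2_set_def sum_3 sum_nonneg)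

lemma quat_in_SU2_iff: "quat a v \<in> SU2 \<longleftrightarrow> a\<^sup>2 + (norm v)\<^sup>2 = 1"
proof -
  have "quat a v \<in> SU2 \<longleftrightarrow> a\<^sup>2 + (v $ 1)\<^sup>2 + (v $ 2)\<^sup>2 + (v $ 3)\<^sup>2 = 1"
    by (auto simp: SU2_def conj_transpose_def matrix_matrix_mult_def vec_eq_iff forall_2 sum_2
        mat_def det_2 complex_eq_iff power2_eq_square algebra_simps)
  then show ?thesis
    by (simp add: norm_real3 add.assoc)
qed

lemma SU2_entries:
  assumes "A \<in> SU2"
  shows "A $ 2 $ 2 = cnj (A $ 1 $ 1)" "A $ 2 $ 1 = - cnj (A $ 1 $ 2)"
proof -
  let ?a = "A $ 1 $ 1" and ?b = "A $ 1 $ 2" and ?c = "A $ 2 $ 1" and ?d = "A $ 2 $ 2"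
  have 1: "cnj ?a * ?a + cnj ?c * ?c = 1" "cnj ?a * ?b + cnj ?c * ?d = 0" and 2: "?a * ?d - ?b * ?c = 1"
    using assms
    by (auto simp: SU2_def conj_transpose_def matrix_matrix_mult_def vec_eq_iff forall_2 sum_2
        mat_def det_2)
  show "?d = cnj ?a" using 1 2 by algebra
  have "- ?b = cnj ?c" using 1 2 by algebra
  then have "cnj (cnj ?c) = cnj (- ?b)" by simp
  then show "?c = - cnj ?b" by simp
qed

lemma quat_parts: "A \<in> SU2 \<Longrightarrow> quat (re_part A) (im_part A) = A"
  by (simp add: vec_eq_iff forall_2 SU2_entries complex_eq_iff re_part_def im_part_def)

lemma parts_sphere: "A \<in> SU2 \<Longrightarrow> (re_part A)\<^sup>2 + (norm (im_part A))\<^sup>2 = 1"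
  using quat_in_SU2_iff[of "re_part A" "im_part A"] quat_parts[of A] by simp

lemma re_part_le_1: "A \<in> SU2 \<Longrightarrow> re_part A \<le> 1"
  using parts_sphere[of A] by (metis abs_le_iff abs_square_le_1 le_add_same_cancel1 zero_le_power2)

lemma re_part_eq_1_iff: "A \<in> SU2 \<Longrightarrow> re_part A = 1 \<longleftrightarrow> A = mat 1"
  using parts_sphere[of A] quat_parts[of A] quat_one re_part_quat[of 1 0]
  by auto

lemma quat_commute_iff:
  "quat a v ** quat b w = quat b w ** quat a v \<longleftrightarrow> cross3 v w = 0"
  by (auto simp: matrix_matrix_mult_def vec_eq_iff forall_2 forall_3 sum_2 complex_eq_iff cross3_def
      algebra_simps)

lemma SU2_commute_iff:
  "A \<in> SU2 \<Longrightarrow> B \<in> SU2 \<Longrightarrow> A ** B = B ** A \<longleftrightarrow> cross3 (im_part A) (im_part B) = 0"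
  using quat_commute_iff[of "re_part A" "im_part A" "re_part B" "im_part B"] by (simp add: quat_parts)

lemma one_in_SU2: "mat 1 \<in> SU2"
  using quat_in_SU2_iff[of 1 0] by (simp add: quat_one)

lemma im_part_one [simp]: "im_part (mat 1) = 0"
  using im_part_quat[of 1 0] by (simp add: quat_one)

lemma re_part_one [simp]: "re_part (mat 1) = 1"
  using re_part_quat[of 1 0] by (simp add: quat_one)

lemma continuous_on_vector_3:
  fixes f g h :: "'a::topological_space \<Rightarrow> real"
  assumes "continuous_on S f" "continuous_on S g" "continuous_on S h"
  shows "continuous_on S (\<lambda>x. vector [f x, g x, h x] :: real^3)"
proof -
  have "continuous_on S (\<lambda>x. (vector [f x, g x, h x] :: real^3) $ i)" for i
    using exhaust_3[of i] assms by auto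
  then have "continuous_on S (\<lambda>x. \<chi> i. (vector [f x, g x, h x] :: real^3) $ i)"
    by (rule continuous_on_vec_lambda)
  then show ?thesis by simp
qed

lemma continuous_on_re_part [continuous_intros]:
  "continuous_on S f \<Longrightarrow> continuous_on S (\<lambda>x. re_part (f x))"
  unfolding re_part_def by (intro continuous_intros)

lemma continuous_on_im_part [continuous_intros]:
  "continuous_on S f \<Longrightarrow> continuous_on S (\<lambda>x. im_part (f x))"
  unfolding im_part_def by (intro continuous_intros continuous_on_vector_3)

lemma continuous_on_quat [continuous_intros]:
  assumes "continuous_on S f" "continuous_on S g"
  shows "continuous_on S (\<lambda>x. quat (f x) (g x))"
proof -
  have c: "continuous_on S (\<lambda>x. g x $ k)" for k
    using assms by (intro continuous_intros)
  have C: "continuous_on S (\<lambda>x. Complex (p x) (r x))"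
    if "continuous_on S p" "continuous_on S r" for p r
    using that unfolding Complex_eq by (intro continuous_intros)
  have "continuous_on S (\<lambda>x. quat (f x) (g x) $ i $ j)" for i j
    using exhaust_2[of i] exhaust_2[of j]
    by (elim disjE; simp only: quat_entries; intro C continuous_on_minus assms c)
  then have "continuous_on S (\<lambda>x. \<chi> i j. quat (f x) (g x) $ i $ j)"
    by (intro continuous_on_vec_lambda)
  then show ?thesis by simp
qed

text \<open>A homotopy of \<open>SU(2)\<close> which contracts a neighbourhood of \<open>1\<close> to \<open>1\<close> and preserves commutation: the
  normalised convex combination \<open>(1 - b) A + b\<close> of quaternions. The weight \<open>b\<close> is positive only if
  the real part of \<open>A\<close> is, so the combination does not vanish; at time \<open>t = 1\<close> it is \<open>1\<close> as soon as the
  real part is at least \<open>1/2\<close>.\<close>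

definition pull :: "real \<Rightarrow> complex^2^2 \<Rightarrow> complex^2^2" where
  "pull t A = (let a = re_part A; b = t * max 0 (min 1 (2 * a));
       N = sqrt ((1 - b)\<^sup>2 + b\<^sup>2 + 2 * b * (1 - b) * a)
     in quat (((1 - b) * a + b) / N) (((1 - b) / N) *\<^sub>R im_part A))"

text \<open>A function that vanishes only at \<open>1\<close> and is less than \<open>1\<close> only where \<open>pull 1\<close> takes the value \<open>1\<close>.\<close>

definition nearness :: "complex^2^2 \<Rightarrow> real" where
  "nearness A = min 1 (2 * (1 - re_part A))"

lemma pull_norm_pos:
  assumes "t \<in> {0..1::real}" "b = t * max 0 (min 1 (2 * a))"
  shows "(1 - b)\<^sup>2 + b\<^sup>2 + 2 * b * (1 - b) * a > 0"
proof (cases "a \<le> 0")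
  case True
  then show ?thesis using assms by simp
next
  case False
  then have "0 \<le> b" "b \<le> 1"
    using assms by (auto intro!: mult_nonneg_nonneg mult_le_one)
  then have "0 \<le> 2 * b * (1 - b) * a" using False by simp
  moreover have "(1 - b)\<^sup>2 + b\<^sup>2 > 0" by (simp add: sum_power2_gt_zero_iff)
  ultimately show ?thesis by linarith
qed

lemma pull_in_SU2:
  assumes "t \<in> {0..1}" "A \<in> SU2"
  shows "pull t A \<in> SU2"
proof -
  define a where "a = re_part A"
  define b where "b = t * max 0 (min 1 (2 * a))"
  define N where "N = (1 - b)\<^sup>2 + b\<^sup>2 + 2 * b * (1 - b) * a"
  have N: "N > 0" unfolding N_def by (rule pull_norm_pos[OF assms(1) b_def])
  have v: "(norm (im_part A))\<^sup>2 = 1 - a\<^sup>2"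
    using parts_sphere[OF assms(2)] by (simp add: a_def)
  have "(((1 - b) * a + b) / sqrt N)\<^sup>2 + (norm (((1 - b) / sqrt N) *\<^sub>R im_part A))\<^sup>2
      = (((1 - b) * a + b)\<^sup>2 + (1 - b)\<^sup>2 * (1 - a\<^sup>2)) / N"
    using N by (simp add: power_divide power_mult_distrib v flip: add_divide_distrib)
  also have "((1 - b) * a + b)\<^sup>2 + (1 - b)\<^sup>2 * (1 - a\<^sup>2) = N"
    unfolding N_def by algebra
  finally show ?thesis
    using N by (simp add: pull_def Let_def quat_in_SU2_iff flip: a_def b_def N_def)
qed

lemma pull_0: "A \<in> SU2 \<Longrightarrow> pull 0 A = A"
  by (simp add: pull_def quat_parts)

lemma pull_one: "pull t (mat 1) = mat 1"
proof -
  have "(1 - t)\<^sup>2 + t\<^sup>2 + 2 * t * (1 - t) = 1" by algebra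
  then show ?thesis by (simp add: pull_def quat_one)
qed

lemma im_part_pull: "\<exists>c. im_part (pull t A) = c *\<^sub>R im_part A"
  by (auto simp: pull_def Let_def)

lemma pull_commute:
  assumes "t \<in> {0..1}" "A \<in> SU2" "B \<in> SU2" "A ** B = B ** A"
  shows "pull t A ** pull t B = pull t B ** pull t A"
proof -
  obtain c d where "im_part (pull t A) = c *\<^sub>R im_part A" "im_part (pull t B) = d *\<^sub>R im_part B"
    using im_part_pull by metis
  then show ?thesis
    using assms SU2_commute_iff[OF assms(2,3)]
    by (simp add: SU2_commute_iff pull_in_SU2 cross_mult_left cross_mult_right)
qed

lemma continuous_on_pull: "continuous_on ({0..1} \<times> SU2) (\<lambda>(t, A). pull t A)"
proof -
  have "(1 - b)\<^sup>2 + b\<^sup>2 + 2 * b * (1 - b) * a \<noteq> 0"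
    if "t \<in> {0..1}" "b = t * max 0 (min 1 (2 * a))" for t a b :: real
    using pull_norm_pos[OF that] by simp
  then show ?thesis
    unfolding pull_def Let_def case_prod_unfold
    by (intro continuous_intros) auto
qed

lemma nearness_range: "A \<in> SU2 \<Longrightarrow> 0 \<le> nearness A \<and> nearness A \<le> 1"
  using re_part_le_1[of A] by (simp add: nearness_def)

lemma nearness_zero_iff: "A \<in> SU2 \<Longrightarrow> nearness A = 0 \<longleftrightarrow> A = mat 1"
  using re_part_eq_1_iff[of A] by (auto simp: nearness_def min_def)

lemma pull_near: "A \<in> SU2 \<Longrightarrow> nearness A < 1 \<Longrightarrow> pull 1 A = mat 1"
  by (simp add: pull_def nearness_def quat_one)

lemma continuous_on_nearness [continuous_intros]:
  "continuous_on S f \<Longrightarrow> continuous_on S (\<lambda>x. nearness (f x))"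
  unfolding nearness_def by (intro continuous_intros)


section \<open>Spaces between the commuting tuples and the wedge\<close>

lemma continuous_map_prod_sum_topology:
  assumes "\<And>i. i \<in> I \<Longrightarrow> continuous_map (prod_topology Z (X i)) Y (\<lambda>(z, x). f (z, (i, x)))"
  shows "continuous_map (prod_topology Z (sum_topology X I)) Y f"
  unfolding continuous_map_def
proof (intro conjI allI impI)
  show "f \<in> topspace (prod_topology Z (sum_topology X I)) \<rightarrow> topspace Y"
    using assms by (fastforce simp: continuous_map_def Pi_iff)
  fix U assume U: "openin Y U"
  show "openin (prod_topology Z (sum_topology X I))
      {p \<in> topspace (prod_topology Z (sum_topology X I)). f p \<in> U}"
    unfolding openin_prod_topology_alt
  proof (intro allI impI)
    fix z w assume zw: "(z, w) \<in> {p \<in> topspace (prod_topology Z (sum_topology X I)). f p \<in> U}"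
    obtain i x where w: "w = (i, x)" by (metis surj_pair)
    with zw have i: "i \<in> I" and zx: "z \<in> topspace Z" "x \<in> topspace (X i)" "f (z, (i, x)) \<in> U"
      by auto
    define W where "W = {p \<in> topspace (prod_topology Z (X i)). (\<lambda>(z, x). f (z, (i, x))) p \<in> U}"
    have "openin (prod_topology Z (X i)) W"
      unfolding W_def by (rule openin_continuous_map_preimage[OF assms[OF i] U])
    moreover have "(z, x) \<in> W"
      using zx by (simp add: W_def)
    ultimately obtain A B where AB: "openin Z A" "openin (X i) B" "z \<in> A" "x \<in> B" "A \<times> B \<subseteq> W"
      unfolding openin_prod_topology_alt by meson
    have "openin (sum_topology X I) ((\<lambda>x. (i, x)) ` B)"
      using open_map_component_injection[OF i, of X] AB(2) by (simp add: open_map_def)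
    moreover have "A \<times> (\<lambda>x. (i, x)) ` B \<subseteq> {p \<in> topspace (prod_topology Z (sum_topology X I)). f p \<in> U}"
      using AB(5) i by (auto simp: W_def)
    ultimately show "\<exists>A B. openin Z A \<and> openin (sum_topology X I) B \<and> z \<in> A \<and> w \<in> B \<and>
        A \<times> B \<subseteq> {p \<in> topspace (prod_topology Z (sum_topology X I)). f p \<in> U}"
      using AB(1,3,4) w by blast
  qed
qed

lemma topspace_commuting_tuples:
  "topspace (commuting_tuples n) =
     {g \<in> {..<n} \<rightarrow>\<^sub>E SU2. \<forall>i<n. \<forall>j<n. g i ** g j = g j ** g i}"
  by (auto simp: commuting_tuples_def)

lemma continuous_map_into_commuting_tuples:
  assumes "\<And>p. p \<in> topspace T \<Longrightarrow> f p \<in> topspace (commuting_tuples n)"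
    and "\<And>i. i < n \<Longrightarrow> continuous_map T euclidean (\<lambda>p. f p i)"
  shows "continuous_map T (commuting_tuples n) f"
  unfolding commuting_tuples_def continuous_map_in_subtopology continuous_map_componentwise
  using assms by (fastforce simp: topspace_commuting_tuples PiE_def extensional_def Pi_iff)

lemma continuous_map_commuting_component:
  assumes "i < n"
  shows "continuous_map (commuting_tuples n) (top_of_set SU2) (\<lambda>g. g i)"
  unfolding commuting_tuples_def
  using assms continuous_map_product_projection[of i "{..<n}" "\<lambda>_. top_of_set SU2"]
  by (intro continuous_map_from_subtopology) simp

definition one_tuple :: "nat \<Rightarrow> nat \<Rightarrow> complex^2^2" where
  "one_tuple n = (\<lambda>i\<in>{..<n}. mat 1)"

text \<open>The tuples in which each entry with index below \<open>k\<close> and outside \<open>T\<close> is \<open>1\<close>.\<close>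

definition supported :: "nat \<Rightarrow> nat \<Rightarrow> nat set \<Rightarrow> (nat \<Rightarrow> complex^2^2) topology" where
  "supported n k T = subtopology (commuting_tuples n) {g. \<forall>j<k. j \<notin> T \<longrightarrow> g j = mat 1}"

text \<open>Disjoint union of these spaces over the sets \<open>T\<close> of indices below \<open>k\<close>.\<close>

definition pieces :: "nat \<Rightarrow> nat \<Rightarrow> (nat set \<times> (nat \<Rightarrow> complex^2^2)) topology" where
  "pieces n k = sum_topology (supported n k) (Pow {..<k})"

text \<open>Tuples with an entry \<open>1\<close> at an index in \<open>T\<close> are sent to the base point. The other ones keep
  their name: for them \<open>T\<close> can be recovered from the tuple.\<close>

definition collapse :: "nat \<Rightarrow> nat set \<times> (nat \<Rightarrow> complex^2^2) \<Rightarrow> nat \<Rightarrow> complex^2^2" where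
  "collapse n = (\<lambda>(T, g). if \<exists>j\<in>T. g j = mat 1 then one_tuple n else g)"

text \<open>A wedge over the sets \<open>T\<close> of indices below \<open>k\<close>. By the choice of \<open>collapse\<close>, its underlying set is that
  of the space of commuting tuples for every \<open>k \<le> n\<close>; only the topology changes with \<open>k\<close>.\<close>

definition stage :: "nat \<Rightarrow> nat \<Rightarrow> (nat \<Rightarrow> complex^2^2) topology" where
  "stage n k = quotient_topology (pieces n k) (collapse n)"

lemma topspace_pieces:
  "topspace (pieces n k) = {(T, g). T \<subseteq> {..<k} \<and> g \<in> topspace (commuting_tuples n) \<and>
     (\<forall>j<k. j \<notin> T \<longrightarrow> g j = mat 1)}"
  by (auto simp: pieces_def supported_def)

lemma pieces_iff:
  "(T, g) \<in> topspace (pieces n k) \<longleftrightarrow> T \<subseteq> {..<k} \<and> g \<in> topspace (commuting_tuples n) \<and>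
     (\<forall>j<k. j \<notin> T \<longrightarrow> g j = mat 1)"
  by (simp add: topspace_pieces)

lemma one_tuple_in: "one_tuple n \<in> topspace (commuting_tuples n)"
  by (auto simp: topspace_commuting_tuples one_tuple_def one_in_SU2)

lemma one_tuple_nth [simp]: "i < n \<Longrightarrow> one_tuple n i = mat 1"
  by (simp add: one_tuple_def)

lemma tuple_in_SU2: "g \<in> topspace (commuting_tuples n) \<Longrightarrow> i < n \<Longrightarrow> g i \<in> SU2"
  by (auto simp: topspace_commuting_tuples)

lemma collapse_in:
  "p \<in> topspace (pieces n k) \<Longrightarrow> collapse n p \<in> topspace (commuting_tuples n)"
  by (auto simp: collapse_def topspace_pieces one_tuple_in)

lemma topspace_stage:
  assumes "k \<le> n"
  shows "topspace (stage n k) = topspace (commuting_tuples n)"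
proof
  show "topspace (stage n k) \<subseteq> topspace (commuting_tuples n)"
    using collapse_in by (auto simp: stage_def)
  show "topspace (commuting_tuples n) \<subseteq> topspace (stage n k)"
  proof
    fix g assume g: "g \<in> topspace (commuting_tuples n)"
    let ?p = "({j. j < k \<and> g j \<noteq> mat 1}, g)"
    have "?p \<in> topspace (pieces n k)" "collapse n ?p = g"
      using g by (auto simp: pieces_iff collapse_def)
    then show "g \<in> topspace (stage n k)"
      by (force simp: stage_def)
  qed
qed

lemma quotient_map_collapse: "quotient_map (pieces n k) (stage n k) (collapse n)"
  unfolding stage_def by (rule quotient_map_quotient_topology)

lemma continuous_map_from_pieces:
  "continuous_map (pieces n k) Y f \<longleftrightarrow>
     (\<forall>T\<subseteq>{..<k}. continuous_map (supported n k T) Y (\<lambda>g. f (T, g)))"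
  by (auto simp: pieces_def continuous_map_from_sum_topology)

lemma continuous_map_into_pieces:
  assumes "T' \<subseteq> {..<k'}" "continuous_map X (commuting_tuples n) f"
    "\<And>x j. x \<in> topspace X \<Longrightarrow> j < k' \<Longrightarrow> j \<notin> T' \<Longrightarrow> f x j = mat 1"
  shows "continuous_map X (pieces n k') (\<lambda>x. (T', f x))"
proof -
  have "continuous_map X (supported n k' T') f"
    unfolding supported_def using assms by (intro continuous_map_into_subtopology) auto
  moreover have "continuous_map (supported n k' T') (pieces n k') (\<lambda>x. (T', x))"
    unfolding pieces_def by (rule continuous_map_component_injection) (use assms in auto)
  ultimately show ?thesis
    using continuous_map_compose by (fastforce simp: o_def)
qed

lemma continuous_map_supported_component:
  assumes "i < n" shows "continuous_map (supported n k T) (top_of_set SU2) (\<lambda>g. g i)"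
  unfolding supported_def
  by (intro continuous_map_from_subtopology continuous_map_commuting_component assms)

lemma continuous_map_supported_id:
  "continuous_map (supported n k T) (commuting_tuples n) (\<lambda>g. g)"
  unfolding supported_def by (intro continuous_map_from_subtopology) simp

lemma topspace_supported:
  "g \<in> topspace (supported n k T) \<longleftrightarrow> g \<in> topspace (commuting_tuples n) \<and> (\<forall>j<k. j \<notin> T \<longrightarrow> g j = mat 1)"
  by (auto simp: supported_def)

lemma update_one_in:
  assumes "g \<in> topspace (commuting_tuples n)" "i < n"
  shows "g(i := mat 1) \<in> topspace (commuting_tuples n)"
  using assms by (auto simp: topspace_commuting_tuples one_in_SU2 PiE_def extensional_def)

lemma continuous_map_update_one:
  assumes "i < n"
  shows "continuous_map (commuting_tuples n) (commuting_tuples n) (\<lambda>g. g(i := mat 1))"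
proof (rule continuous_map_into_commuting_tuples)
  fix j assume "j < n"
  then have "continuous_map (commuting_tuples n) euclidean (\<lambda>g. g j)"
    by (rule continuous_map_into_fulltopology[OF continuous_map_commuting_component])
  then show "continuous_map (commuting_tuples n) euclidean (\<lambda>g. (g(i := mat 1)) j)"
    by (cases "j = i") auto
qed (rule update_one_in[OF _ assms])

definition pull_tuple :: "nat \<Rightarrow> real \<Rightarrow> (nat \<Rightarrow> complex^2^2) \<Rightarrow> nat \<Rightarrow> complex^2^2" where
  "pull_tuple n t g = (\<lambda>i\<in>{..<n}. pull t (g i))"

lemma pull_tuple_in:
  assumes "g \<in> topspace (commuting_tuples n)" "t \<in> {0..1}"
  shows "pull_tuple n t g \<in> topspace (commuting_tuples n)"
  using assms by (auto simp: topspace_commuting_tuples pull_tuple_def Pi_iff intro!: pull_in_SU2 pull_commute)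

lemma continuous_map_pull_tuple:
  "continuous_map (prod_topology (top_of_set {0..1}) (commuting_tuples n)) (commuting_tuples n)
     (\<lambda>(t, g). pull_tuple n t g)"
proof (rule continuous_map_into_commuting_tuples)
  fix i assume i: "i < n"
  let ?P = "prod_topology (top_of_set {0..1::real}) (commuting_tuples n)"
  have "continuous_map ?P (prod_topology (top_of_set {0..1}) (top_of_set SU2)) (\<lambda>p. (fst p, snd p i))"
    using continuous_map_compose[OF continuous_map_snd continuous_map_commuting_component[OF i], of "top_of_set {0..1::real}"]
    unfolding continuous_map_pairwise o_def fst_conv snd_conv
    by (intro conjI continuous_map_fst)
  moreover have "continuous_map (prod_topology (top_of_set {0..1}) (top_of_set SU2)) euclidean (\<lambda>(t, A). pull t A)"
    using continuous_on_pull by (simp add: prod_topology_subtopology_eu)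
  ultimately have "continuous_map ?P euclidean ((\<lambda>(t, A). pull t A) \<circ> (\<lambda>p. (fst p, snd p i)))"
    by (rule continuous_map_compose)
  then show "continuous_map ?P euclidean (\<lambda>p. (case p of (t, g) \<Rightarrow> pull_tuple n t g) i)"
    using i by (simp add: o_def case_prod_unfold pull_tuple_def)
qed (use pull_tuple_in in auto)

lemma pieces_determined:
  assumes "(T, g) \<in> topspace (pieces n k)" "\<forall>j\<in>T. g j \<noteq> mat 1"
  shows "T = {j. j < k \<and> g j \<noteq> mat 1}"
  using assms by (auto simp: pieces_iff)

text \<open>The homotopy \<open>pull\<close>, applied to all entries at once, descends to the stages. A tuple may be moved
  into the base point, but never out of it.\<close>

lemma collapse_pull:
  assumes p: "(T, g) \<in> topspace (pieces n k)" "(T', g') \<in> topspace (pieces n k)" "k \<le> n" "t \<in> {0..1}"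
    and eq: "collapse n (T, g) = collapse n (T', g')"
  shows "collapse n (T, pull_tuple n t g) = collapse n (T', pull_tuple n t g')"
proof -
  have T: "T \<subseteq> {..<n}" "T' \<subseteq> {..<n}" using p by (auto simp: pieces_iff)
  have pull1: "collapse n (T, pull_tuple n t g) = one_tuple n"
    if "\<exists>j\<in>T. g j = mat 1" "T \<subseteq> {..<n}" for T g
    using that by (auto simp: collapse_def pull_tuple_def pull_one subset_iff)
  have one: "collapse n (T, pull_tuple n t g) = one_tuple n"
    if "g = one_tuple n" for T g
    using that by (auto simp: collapse_def pull_tuple_def one_tuple_def pull_one)
  consider "\<exists>j\<in>T. g j = mat 1" "\<exists>j\<in>T'. g' j = mat 1"
    | "\<exists>j\<in>T. g j = mat 1" "g' = one_tuple n" | "g = one_tuple n" "\<exists>j\<in>T'. g' j = mat 1"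
    | "\<forall>j\<in>T. g j \<noteq> mat 1" "\<forall>j\<in>T'. g' j \<noteq> mat 1" "g = g'"
    using eq by (auto simp: collapse_def split: if_splits)
  then show ?thesis
  proof cases
    case 4
    have "T = T'"
      using pieces_determined[OF p(1) 4(1)] pieces_determined[OF p(2) 4(2)] 4(3) by simp
    with 4(3) show ?thesis by simp
  qed (use pull1 one T in simp_all)
qed

lemma quotient_map_forget:
  assumes "i < n"
  shows "quotient_map (pieces n (Suc i)) (pieces n i) (\<lambda>(T, g). (T - {i}, g))"
proof (rule retraction_imp_quotient_map)
  have "continuous_map (pieces n (Suc i)) (pieces n i) (\<lambda>(T, g). (T - {i}, g))"
    unfolding continuous_map_from_pieces case_prod_conv
    by (intro allI impI continuous_map_into_pieces continuous_map_supported_id)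
      (auto simp: topspace_supported)
  moreover have "continuous_map (pieces n i) (pieces n (Suc i)) (\<lambda>(T, g). (insert i T, g))"
    unfolding continuous_map_from_pieces case_prod_conv
    by (intro allI impI continuous_map_into_pieces continuous_map_supported_id)
      (auto simp: topspace_supported less_Suc_eq)
  ultimately show "retraction_map (pieces n (Suc i)) (pieces n i) (\<lambda>(T, g). (T - {i}, g))"
    unfolding retraction_map_def retraction_maps_def
    by (intro exI[of _ "\<lambda>(T, g). (insert i T, g)"]) (auto simp: pieces_iff)
qed

text \<open>The function \<open>lam\<close> for the step at index \<open>i\<close>. The product runs over all of \<open>T\<close>, since tuples near the
  base point must be moved into it too.\<close>

definition weight :: "nat \<Rightarrow> nat set \<times> (nat \<Rightarrow> complex^2^2) \<Rightarrow> real" where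
  "weight i = (\<lambda>(T, g). if i \<in> T then \<Prod>j\<in>T. nearness (g j) else 0)"

lemma weight_zero_iff:
  assumes "(T, g) \<in> topspace (pieces n k)" "k \<le> n"
  shows "weight i (T, g) = 0 \<longleftrightarrow> i \<notin> T \<or> (\<exists>j\<in>T. g j = mat 1)"
proof -
  have "T \<subseteq> {..<n}" using assms by (auto simp: pieces_iff)
  moreover have "finite T" using calculation finite_subset by blast
  ultimately show ?thesis
    using assms nearness_zero_iff[OF tuple_in_SU2] by (auto simp: weight_def pieces_iff subset_iff)
qed

lemma weight_range:
  assumes "(T, g) \<in> topspace (pieces n k)" "k \<le> n"
  shows "0 \<le> weight i (T, g) \<and> weight i (T, g) \<le> 1"
  using assms nearness_range[OF tuple_in_SU2]
  by (auto simp: weight_def pieces_iff subset_iff intro!: prod_nonneg prod_le_1)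

lemma weight_near:
  assumes "(T, g) \<in> topspace (pieces n k)" "k \<le> n" "weight i (T, g) < 1" "i \<in> T"
  shows "\<exists>j\<in>T. pull_tuple n 1 g j = mat 1"
proof -
  have T: "T \<subseteq> {..<n}" using assms by (auto simp: pieces_iff)
  have "\<exists>j\<in>T. nearness (g j) \<noteq> 1"
  proof (rule ccontr)
    assume "\<not> ?thesis"
    then have "weight i (T, g) = 1" using assms(4) by (simp add: weight_def)
    then show False using assms(3) by simp
  qed
  then obtain j where j: "j \<in> T" "nearness (g j) \<noteq> 1" by blast
  then have "g j \<in> SU2" using assms T by (auto simp: pieces_iff intro: tuple_in_SU2)
  then have "pull 1 (g j) = mat 1"
    using j nearness_range[of "g j"] by (intro pull_near) auto
  then show ?thesis using j T by (auto simp: pull_tuple_def)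
qed

text \<open>Both stages are quotients of \<open>pieces n (Suc i)\<close>: for the earlier one the index \<open>i\<close> is dropped from \<open>T\<close>.
  The common retract consists of the tuples with entry \<open>1\<close> at \<open>i\<close>.\<close>

lemma stage_step_quotients:
  assumes i: "i < n"
  shows "common_quotients (pieces n (Suc i)) (stage n i) (stage n (Suc i))
     (\<lambda>(T, g). collapse n (T - {i}, g)) (collapse n)
     (\<lambda>g. g(i := mat 1)) (\<lambda>g. if g i = mat 1 then g else one_tuple n)
     (weight i) (\<lambda>t (T, g). (T, pull_tuple n t g))"
    (is "common_quotients ?S ?X ?Y ?q ?q' ?e ?e' ?lam ?H")
proof
  have topX: "topspace ?X = topspace (commuting_tuples n)" and topY: "topspace ?Y = topspace (commuting_tuples n)"
    using i by (auto simp: topspace_stage)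
  have forget: "(T - {i}, g) \<in> topspace (pieces n i)" if "(T, g) \<in> topspace ?S" for T g
    using that by (auto simp: pieces_iff)
  have Tn: "T \<subseteq> {..<n}" if "(T, g) \<in> topspace ?S" for T g
    using that i by (auto simp: pieces_iff)
  have q_i: "?q s i = mat 1 \<Longrightarrow> weight i s = 0" and q'_i: "?q' s i = mat 1 \<Longrightarrow> weight i s = 0"
    if "s \<in> topspace ?S" for s
  proof -
    obtain T g where s: "s = (T, g)" by (metis surj_pair)
    have "weight i s = 0 \<longleftrightarrow> i \<notin> T \<or> (\<exists>j\<in>T. g j = mat 1)"
      using that i weight_zero_iff[of T g n "Suc i" i] by (simp add: s)
    moreover have "(T, g) \<in> topspace ?S" using that s by simp
    ultimately show "?q s i = mat 1 \<Longrightarrow> weight i s = 0" "?q' s i = mat 1 \<Longrightarrow> weight i s = 0"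
      by (auto simp: s collapse_def split: if_splits)
  qed
  show "quotient_map ?S ?X ?q"
    using quotient_map_compose[OF quotient_map_forget[OF i] quotient_map_collapse]
    by (simp add: o_def case_prod_unfold)
  show "quotient_map ?S ?Y ?q'"
    by (rule quotient_map_collapse)
  show "continuous_map ?X ?Y ?e"
  proof (rule continuous_compose_quotient_map[OF quotient_map_collapse])
    have "continuous_map (pieces n i) ?Y (collapse n \<circ> (\<lambda>(T, g). (T, g(i := mat 1))))"
      unfolding continuous_map_from_pieces o_def case_prod_conv
      by (intro allI impI continuous_map_into_pieces continuous_map_supported_id
        continuous_map_compose[OF continuous_map_supported_id continuous_map_update_one[OF i], unfolded o_def]
        continuous_map_compose[OF _ quotient_imp_continuous_map[OF quotient_map_collapse], unfolded o_def])
        (auto simp: topspace_supported)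
    then show "continuous_map (pieces n i) ?Y (?e \<circ> collapse n)"
      by (rule continuous_map_eq)
        (use i in \<open>auto simp: collapse_def topspace_pieces one_tuple_def restrict_def fun_eq_iff\<close>)
  qed
  show "continuous_map ?Y ?X ?e'"
  proof (rule continuous_compose_quotient_map[OF quotient_map_collapse])
    have "continuous_map ?S (pieces n i) (\<lambda>(T, g). if i \<in> T then ({}, one_tuple n) else (T, g))"
      unfolding continuous_map_from_pieces
    proof (intro allI impI)
      fix T assume T: "T \<subseteq> {..<Suc i}"
      show "continuous_map (supported n (Suc i) T) (pieces n i)
          (\<lambda>g. case (T, g) of (T, g) \<Rightarrow> if i \<in> T then ({}, one_tuple n) else (T, g))"
      proof (cases "i \<in> T")
        case True
        then show ?thesis using i by (simp add: pieces_iff one_tuple_in)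
      next
        case False
        then have "T \<subseteq> {..<i}" using T by (auto simp: less_Suc_eq)
        then show ?thesis
          using False i
          by (simp, intro continuous_map_into_pieces continuous_map_supported_id) (auto simp: topspace_supported)
      qed
    qed
    from continuous_map_compose[OF this quotient_imp_continuous_map[OF quotient_map_collapse]]
    show "continuous_map ?S ?X (?e' \<circ> collapse n)"
      by (rule continuous_map_eq) (use i in \<open>auto simp: collapse_def pieces_iff\<close>)
  qed
  show "?e (?e' (?e x)) = ?e x" for x by simp
  show "?e' (?e (?e' y)) = ?e' y" for y using i by auto
  show "continuous_map ?S euclideanreal ?lam"
    unfolding continuous_map_from_pieces
  proof (intro allI impI)
    fix T assume T: "T \<subseteq> {..<Suc i}"
    have "continuous_map (supported n (Suc i) T) euclideanreal (\<lambda>g. nearness (g j))" if "j \<in> T" for j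
    proof -
      have near: "continuous_map (top_of_set SU2) euclideanreal nearness"
        by (simp add: continuous_on_nearness)
      have "j < n" using that T i by auto
      from continuous_map_compose[OF continuous_map_supported_component[OF this] near]
      show ?thesis by (simp add: o_def)
    qed
    moreover have "finite T" using T finite_subset by blast
    ultimately show "continuous_map (supported n (Suc i) T) euclideanreal (\<lambda>g. weight i (T, g))"
      by (cases "i \<in> T") (auto simp: weight_def intro!: continuous_intros)
  qed
  show "0 \<le> ?lam s \<and> ?lam s \<le> 1" if "s \<in> topspace ?S" for s
    using that weight_range[of "fst s" "snd s" n "Suc i" i] i by simp
  show "continuous_map (prod_topology (top_of_set {0..1}) ?S) ?S (\<lambda>(t, s). ?H t s)"
    unfolding pieces_def
  proof (rule continuous_map_prod_sum_topology)
    fix T assume T: "T \<in> Pow {..<Suc i}"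
    let ?P = "prod_topology (top_of_set {0..1::real}) (supported n (Suc i) T)"
    have "continuous_map ?P (prod_topology (top_of_set {0..1}) (commuting_tuples n)) (\<lambda>p. (fst p, snd p))"
      using continuous_map_compose[OF continuous_map_snd continuous_map_supported_id, of "top_of_set {0..1::real}" n "Suc i" T]
      unfolding continuous_map_pairwise o_def fst_conv snd_conv
      by (intro conjI continuous_map_fst)
    from continuous_map_compose[OF this continuous_map_pull_tuple]
    have "continuous_map ?P (commuting_tuples n) (\<lambda>(t, g). pull_tuple n t g)"
      by (simp add: o_def case_prod_unfold)
    then have "continuous_map ?P ?S (\<lambda>p. (T, (\<lambda>(t, g). pull_tuple n t g) p))"
      using T i
      by (intro continuous_map_into_pieces) (auto simp: topspace_supported pull_tuple_def pull_one)
    then show "continuous_map ?P (sum_topology (supported n (Suc i)) (Pow {..<Suc i}))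
        (\<lambda>(z, x). (\<lambda>(t, s). ?H t s) (z, T, x))"
      by (simp add: pieces_def case_prod_unfold)
  qed
  show "?H 0 s = s" if "s \<in> topspace ?S" for s
    using that
    by (auto simp: topspace_pieces pull_tuple_def topspace_commuting_tuples PiE_def extensional_def fun_eq_iff
        intro!: pull_0)
  have nonzero: "s = s'"
    if "s \<in> topspace ?S" "s' \<in> topspace ?S" "?q s = ?q s' \<or> ?q' s = ?q' s'" "weight i s \<noteq> 0" for s s'
  proof -
    obtain T g T' g' where s: "s = (T, g)" "s' = (T', g')" by (metis surj_pair)
    have g: "i \<in> T" "\<forall>j\<in>T. g j \<noteq> mat 1"
      using that i by (auto simp: s weight_zero_iff[where k = "Suc i"])
    then have gi: "g \<noteq> one_tuple n" using i by auto
    have "g' = g" "\<forall>j\<in>T' - {i}. g' j \<noteq> mat 1"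
      using that(3) g gi by (auto simp: s collapse_def split: if_splits)
    moreover have "i \<in> T'"
      using g calculation that(2) by (auto simp: s pieces_iff)
    ultimately have g': "\<forall>j\<in>T'. g' j \<noteq> mat 1" using g by auto
    have "T = T'"
      using pieces_determined[OF that(1)[unfolded s] g(2)] pieces_determined[OF that(2)[unfolded s] g']
        \<open>g' = g\<close> by simp
    then show ?thesis using \<open>g' = g\<close> by (simp add: s)
  qed
  show "s = s' \<or> ?lam s = 0 \<and> ?lam s' = 0" if "s \<in> topspace ?S" "s' \<in> topspace ?S" "?q s = ?q s'" for s s'
    using nonzero[of s s'] nonzero[of s' s] that by metis
  show "s = s' \<or> ?lam s = 0 \<and> ?lam s' = 0" if "s \<in> topspace ?S" "s' \<in> topspace ?S" "?q' s = ?q' s'" for s s'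
    using nonzero[of s s'] nonzero[of s' s] that by metis
  show "?lam s = 0" if "s \<in> topspace ?S" "y \<in> topspace ?Y" "?q s = ?e' y" for s y
    by (rule q_i[OF that(1)]) (use that(3) i in simp)
  show "?lam s = 0" if "s \<in> topspace ?S" "x \<in> topspace ?X" "?q' s = ?e x" for s x
    by (rule q'_i[OF that(1)]) (use that(3) in simp)
  have near: "?q (?H 1 s) i = mat 1 \<and> ?q' (?H 1 s) i = mat 1 \<and>
      ?q (?H 1 s) \<in> topspace (commuting_tuples n) \<and> ?q' (?H 1 s) \<in> topspace (commuting_tuples n)"
    if s: "s \<in> topspace ?S" "?lam s < 1" for s
  proof -
    obtain T g where Tg: "s = (T, g)" by (metis surj_pair)
    have H: "(T, pull_tuple n 1 g) \<in> topspace ?S"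
      using s i by (auto simp: Tg pieces_iff pull_tuple_in) (auto simp: pull_tuple_def pull_one)
    show ?thesis
    proof (cases "i \<in> T")
      case True
      obtain j where "j \<in> T" "pull_tuple n 1 g j = mat 1"
        using weight_near[of T g n "Suc i" i] s i True unfolding Tg by auto
      then show ?thesis
        using i collapse_in[OF H] collapse_in[OF forget[OF H]]
        by (cases "j = i") (auto simp: Tg collapse_def)
    next
      case False
      then have "pull_tuple n 1 g i = mat 1" using H by (auto simp: pieces_iff)
      then show ?thesis
        using i collapse_in[OF H] collapse_in[OF forget[OF H]]
        by (auto simp: Tg collapse_def)
    qed
  qed
  show "?q (?H 1 s) \<in> ?e' ` topspace ?Y" if "s \<in> topspace ?S" "?lam s < 1" for s
    unfolding topY by (rule image_eqI[of _ _ "?q (?H 1 s)"]) (use near[OF that] in auto)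
  show "?q' (?H 1 s) \<in> ?e ` topspace ?X" if "s \<in> topspace ?S" "?lam s < 1" for s
    unfolding topX by (rule image_eqI[of _ _ "?q' (?H 1 s)"]) (use near[OF that] fun_upd_triv[of "?q' (?H 1 s)" i] in auto)
  show "?q (?H t s) = ?q (?H t s')"
    if "s \<in> topspace ?S" "s' \<in> topspace ?S" "?q s = ?q s'" "t \<in> {0..1}" for s s' t
    using that collapse_pull[OF forget forget, of "fst s" "snd s" "fst s'" "snd s'" t] i
    by (simp add: case_prod_unfold)
  show "?q' (?H t s) = ?q' (?H t s')"
    if "s \<in> topspace ?S" "s' \<in> topspace ?S" "?q' s = ?q' s'" "t \<in> {0..1}" for s s' t
    using that collapse_pull[of "fst s" "snd s" n "Suc i" "fst s'" "snd s'" t] i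
    by (simp add: case_prod_unfold)
qed

lemma commuting_tuples_homeomorphic_stage_0: "commuting_tuples n homeomorphic_space stage n 0"
proof -
  have "continuous_map (commuting_tuples n) (pieces n 0) (\<lambda>g. ({}, g))"
    by (intro continuous_map_into_pieces) auto
  from continuous_map_compose[OF this quotient_imp_continuous_map[OF quotient_map_collapse]]
  have 1: "continuous_map (commuting_tuples n) (stage n 0) id"
    by (simp add: o_def collapse_def id_def)
  have "continuous_map (pieces n 0) (commuting_tuples n) (id \<circ> collapse n)"
    by (simp add: continuous_map_from_pieces collapse_def continuous_map_supported_id)
  then have 2: "continuous_map (stage n 0) (commuting_tuples n) id"
    by (rule continuous_compose_quotient_map[OF quotient_map_collapse])
  show ?thesis
    unfolding homeomorphic_space_def homeomorphic_maps_def
    by (rule exI[of _ id], rule exI[of _ id]) (use 1 2 in simp)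
qed

lemma suspension_commuting_tuples_stage:
  "k \<le> n \<Longrightarrow> suspension (commuting_tuples n) homotopy_equivalent_space suspension (stage n k)"
proof (induction k)
  case 0
  show ?case
    by (rule homeomorphic_imp_suspension_homotopy_equivalent[OF commuting_tuples_homeomorphic_stage_0])
next
  case (Suc i)
  then have "suspension (stage n i) homotopy_equivalent_space suspension (stage n (Suc i))"
    by (intro common_quotients.suspension_homotopy_equivalent[OF stage_step_quotients]) simp
  with Suc show ?case
    using homotopy_eqv_trans by fastforce
qed


section \<open>The last space is Hausdorff\<close>

lemma separated_by_continuous_map:
  fixes f :: "'a \<Rightarrow> 'b::t2_space"
  assumes "continuous_map X euclidean f" "x \<in> topspace X" "y \<in> topspace X" "f x \<noteq> f y"
  shows "\<exists>U V. openin X U \<and> openin X V \<and> x \<in> U \<and> y \<in> V \<and> disjnt U V"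
proof -
  obtain U V where UV: "open U" "open V" "f x \<in> U" "f y \<in> V" "U \<inter> V = {}"
    using hausdorff[OF assms(4)] by blast
  have "openin X {z \<in> topspace X. f z \<in> U}" "openin X {z \<in> topspace X. f z \<in> V}"
    using UV assms(1) by (auto intro: openin_continuous_map_preimage)
  then show ?thesis
    using UV assms(2,3) by (intro exI[of _ "{z \<in> topspace X. f z \<in> U}"] exI[of _ "{z \<in> topspace X. f z \<in> V}"])
      (auto simp: disjnt_iff)
qed

text \<open>A function on the last stage which is nonzero exactly on the open cell of \<open>T\<close>, for nonempty \<open>T\<close>.
  These functions and their products with the entries separate points.\<close>

definition bump :: "nat \<Rightarrow> nat set \<Rightarrow> (nat \<Rightarrow> complex^2^2) \<Rightarrow> real" where
  "bump n T g = (if {j. j < n \<and> g j \<noteq> mat 1} = T then \<Prod>j\<in>T. nearness (g j) else 0)"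

lemma bump_collapse:
  assumes "(T', g) \<in> topspace (pieces n n)" "T \<noteq> {}"
  shows "bump n T (collapse n (T', g)) = (if T' = T then \<Prod>j\<in>T. nearness (g j) else 0)"
    and "bump n T (collapse n (T', g)) *\<^sub>R collapse n (T', g) i =
      (if T' = T then (\<Prod>j\<in>T. nearness (g j)) *\<^sub>R g i else 0)"
proof -
  have "finite T'" "T' \<subseteq> {..<n}"
    using assms(1) finite_subset by (auto simp: pieces_iff)
  have "bump n T (collapse n (T', g)) = (if T' = T then \<Prod>j\<in>T. nearness (g j) else 0) \<and>
      bump n T (collapse n (T', g)) *\<^sub>R collapse n (T', g) i =
      (if T' = T then (\<Prod>j\<in>T. nearness (g j)) *\<^sub>R g i else 0)"
  proof (cases "\<exists>j\<in>T'. g j = mat 1")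
    case True
    then obtain j where j: "j \<in> T'" "g j = mat 1" by blast
    have "nearness (g j) = 0" using j one_in_SU2 by (simp add: nearness_zero_iff)
    then have "(\<Prod>j\<in>T'. nearness (g j)) = 0"
      using \<open>finite T'\<close> j by (intro prod_zero) (auto intro!: bexI[of _ j])
    moreover have none: "{j. j < n \<and> one_tuple n j \<noteq> mat 1} = {}" by auto
    have "bump n T (one_tuple n) = 0" unfolding bump_def none using assms(2) by auto
    moreover have "collapse n (T', g) = one_tuple n" using True by (simp add: collapse_def)
    ultimately show ?thesis by auto
  next
    case False
    then have "collapse n (T', g) = g" "T' = {j. j < n \<and> g j \<noteq> mat 1}"
      using pieces_determined[OF assms(1)] by (auto simp: collapse_def)
    then show ?thesis by (auto simp: bump_def)
  qed
  then show "bump n T (collapse n (T', g)) = (if T' = T then \<Prod>j\<in>T. nearness (g j) else 0)"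
    and "bump n T (collapse n (T', g)) *\<^sub>R collapse n (T', g) i =
      (if T' = T then (\<Prod>j\<in>T. nearness (g j)) *\<^sub>R g i else 0)" by auto
qed

lemma continuous_map_supported_entry:
  assumes "j < n" "continuous_on SU2 f"
  shows "continuous_map (supported n k T) euclidean (\<lambda>g. f (g j))"
proof -
  have "continuous_map (top_of_set SU2) euclidean f" using assms(2) by simp
  from continuous_map_compose[OF continuous_map_supported_component[OF assms(1)] this]
  show ?thesis by (simp add: o_def)
qed

lemma continuous_map_bump:
  assumes "T \<noteq> {}" "i < n"
  shows "continuous_map (stage n n) euclidean (bump n T)"
    and "continuous_map (stage n n) euclidean (\<lambda>g. bump n T g *\<^sub>R g i)"
proof -
  have prod: "continuous_map (supported n n T') euclideanreal (\<lambda>g. \<Prod>j\<in>T'. nearness (g j))"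
    if "T' \<subseteq> {..<n}" for T'
    using that finite_subset
    by (intro continuous_map_prod continuous_map_supported_entry continuous_on_nearness) auto
  have "continuous_map (pieces n n) euclideanreal (\<lambda>(T', g). if T' = T then \<Prod>j\<in>T. nearness (g j) else 0)"
    unfolding continuous_map_from_pieces using prod by auto
  then have "continuous_map (pieces n n) euclideanreal (bump n T \<circ> collapse n)"
    by (rule continuous_map_eq) (auto simp: bump_collapse assms)
  then show "continuous_map (stage n n) euclidean (bump n T)"
    by (rule continuous_compose_quotient_map[OF quotient_map_collapse])
  have entry: "continuous_map (supported n n T') euclidean (\<lambda>g. g i)" for T'
    by (rule continuous_map_supported_entry[OF assms(2)]) (rule continuous_on_id)
  have "continuous_map (pieces n n) euclidean
      (\<lambda>(T', g). if T' = T then (\<Prod>j\<in>T. nearness (g j)) *\<^sub>R g i else 0)"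
    unfolding continuous_map_from_pieces
  proof (intro allI impI)
    fix T' assume "T' \<subseteq> {..<n}"
    then have "continuous_map (supported n n T') euclidean (\<lambda>g. (\<Prod>j\<in>T'. nearness (g j)) *\<^sub>R g i)"
      using prod entry by (simp add: continuous_map_atin tendsto_scaleR)
    then show "continuous_map (supported n n T') euclidean
        (\<lambda>g. case (T', g) of (T', g) \<Rightarrow> if T' = T then (\<Prod>j\<in>T. nearness (g j)) *\<^sub>R g i else 0)"
      by (cases "T' = T") simp_all
  qed
  then have "continuous_map (pieces n n) euclidean ((\<lambda>g. bump n T g *\<^sub>R g i) \<circ> collapse n)"
    by (rule continuous_map_eq) (auto simp: bump_collapse(2)[OF _ assms(1)])
  then show "continuous_map (stage n n) euclidean (\<lambda>g. bump n T g *\<^sub>R g i)"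
    by (rule continuous_compose_quotient_map[OF quotient_map_collapse])
qed

lemma Hausdorff_space_last_stage:
  assumes "n \<ge> 1"
  shows "Hausdorff_space (stage n n)"
  unfolding Hausdorff_space_def
proof (intro allI impI, elim conjE)
  fix g g' assume g: "g \<in> topspace (stage n n)" "g' \<in> topspace (stage n n)" "g \<noteq> g'"
  then have gt: "g \<in> topspace (commuting_tuples n)" "g' \<in> topspace (commuting_tuples n)"
    by (simp_all add: topspace_stage)
  let ?supp = "\<lambda>g. {j. j < n \<and> g j \<noteq> mat 1}"
  have pos: "bump n (?supp g) g \<noteq> 0" if "g \<in> topspace (commuting_tuples n)" for g
    using that by (auto simp: bump_def nearness_zero_iff tuple_in_SU2)
  have zero: "bump n T g = 0" if "T \<noteq> ?supp g" for T g
    using that by (auto simp: bump_def)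
  note sep = separated_by_continuous_map[OF _ g(1,2)]
  have "\<exists>i<n. g i \<noteq> g' i"
  proof (rule ccontr)
    assume "\<not> ?thesis"
    moreover have "g \<in> extensional {..<n}" "g' \<in> extensional {..<n}"
      using gt by (auto simp: topspace_commuting_tuples PiE_def)
    ultimately have "g = g'" by (intro extensionalityI[of g "{..<n}" g']) auto
    then show False using g(3) by simp
  qed
  then obtain i where i: "i < n" "g i \<noteq> g' i" by blast
  show "\<exists>U V. openin (stage n n) U \<and> openin (stage n n) V \<and> g \<in> U \<and> g' \<in> V \<and> disjnt U V"
  proof (cases "?supp g = ?supp g'")
    case True
    define T where "T = ?supp g"
    have T: "T \<noteq> {}"
    proof
      assume "T = {}"
      then have "i \<notin> ?supp g" "i \<notin> ?supp g'" using True unfolding T_def by simp_all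
      then show False using i by simp
    qed
    have b: "bump n T g \<noteq> 0" unfolding T_def by (rule pos[OF gt(1)])
    have b': "bump n T g' \<noteq> 0" unfolding T_def True by (rule pos[OF gt(2)])
    show ?thesis
    proof (cases "bump n T g = bump n T g'")
      case True
      then have "bump n T g *\<^sub>R g i \<noteq> bump n T g' *\<^sub>R g' i" using b b' i by simp
      then show ?thesis by (rule sep[OF continuous_map_bump(2)[OF T i(1)]])
    next
      case False
      then show ?thesis by (rule sep[OF continuous_map_bump(1)[OF T i(1)]])
    qed
  next
    case False
    then consider "?supp g \<noteq> {}" | "?supp g' \<noteq> {}" by auto
    then show ?thesis
    proof cases
      case 1
      show ?thesis
        by (rule sep[OF continuous_map_bump(1)[OF 1 i(1)]]) (use pos[OF gt(1)] zero False in auto)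
    next
      case 2
      show ?thesis
        by (rule sep[OF continuous_map_bump(1)[OF 2 i(1)]]) (use pos[OF gt(2)] zero False in auto)
    qed
  qed
qed

text \<open>The closed unit ball modulo its boundary is the 3-sphere: the centre goes to \<open>-1\<close>, the boundary to \<open>1\<close>,
  and the imaginary part keeps its direction.\<close>

definition ball_to_SU2 :: "real^3 \<Rightarrow> complex^2^2" where
  "ball_to_SU2 w = quat (2 * (norm w)\<^sup>2 - 1) ((2 * sqrt (1 - (norm w)\<^sup>2)) *\<^sub>R w)"

lemma ball_to_SU2_in:
  assumes "norm w \<le> 1"
  shows "ball_to_SU2 w \<in> SU2"
proof -
  have "(norm w)\<^sup>2 \<le> 1" using assms by (simp add: power_le_one)
  then have "(norm ((2 * sqrt (1 - (norm w)\<^sup>2)) *\<^sub>R w))\<^sup>2 = 4 * (1 - (norm w)\<^sup>2) * (norm w)\<^sup>2"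
    by (simp add: power_mult_distrib)
  moreover have "(2 * x - 1)\<^sup>2 + 4 * (1 - x) * x = 1" for x :: real
    by (simp add: power2_eq_square algebra_simps)
  ultimately show ?thesis
    unfolding ball_to_SU2_def quat_in_SU2_iff by simp
qed

lemma ball_to_SU2_eq_one_iff:
  assumes "norm w \<le> 1"
  shows "ball_to_SU2 w = mat 1 \<longleftrightarrow> norm w = 1"
proof -
  have "ball_to_SU2 w = mat 1 \<longleftrightarrow> re_part (ball_to_SU2 w) = 1"
    using re_part_eq_1_iff[OF ball_to_SU2_in[OF assms]] by simp
  also have "\<dots> \<longleftrightarrow> (norm w)\<^sup>2 = 1" by (simp add: ball_to_SU2_def)
  also have "\<dots> \<longleftrightarrow> norm w = 1" 
  proof -
    have "norm w \<noteq> - 1" using norm_ge_zero[of w] by linarith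
    then show ?thesis by (simp add: power2_eq_1_iff)
  qed
  finally show ?thesis .
qed

lemma ball_to_SU2_inj:
  assumes "norm w < 1" "ball_to_SU2 w = ball_to_SU2 w'"
  shows "w = w'"
proof -
  have "re_part (ball_to_SU2 w) = re_part (ball_to_SU2 w')" "im_part (ball_to_SU2 w) = im_part (ball_to_SU2 w')"
    using assms(2) by simp_all
  then have 1: "(norm w)\<^sup>2 = (norm w')\<^sup>2"
    and 2: "(2 * sqrt (1 - (norm w)\<^sup>2)) *\<^sub>R w = (2 * sqrt (1 - (norm w')\<^sup>2)) *\<^sub>R w'"
    by (simp_all add: ball_to_SU2_def)
  have "(norm w)\<^sup>2 < 1" using assms(1) by (simp add: power_less_one_iff abs_square_less_1)
  then have "2 * sqrt (1 - (norm w)\<^sup>2) \<noteq> 0" by simp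
  then show ?thesis using 2 unfolding 1 by simp
qed

text \<open>The inverse of \<open>ball_to_SU2\<close> away from \<open>1\<close>.\<close>

definition SU2_to_ball :: "complex^2^2 \<Rightarrow> real^3" where
  "SU2_to_ball A = (1 / sqrt (2 * (1 - re_part A))) *\<^sub>R im_part A"

lemma ball_to_SU2_surj:
  assumes "A \<in> SU2" "A \<noteq> mat 1"
  shows "norm (SU2_to_ball A) < 1" "ball_to_SU2 (SU2_to_ball A) = A"
proof -
  define a where "a = re_part A"
  have a: "a < 1" using assms re_part_le_1[of A] re_part_eq_1_iff[of A] by (simp add: a_def)
  have im: "(norm (im_part A))\<^sup>2 = (1 - a) * (1 + a)"
    using parts_sphere[OF assms(1)] by (simp add: a_def power2_eq_square algebra_simps)
  have "(norm (SU2_to_ball A))\<^sup>2 = ((1 - a) * (1 + a)) / (2 * (1 - a))"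
    using a by (simp add: SU2_to_ball_def power_mult_distrib power_divide im flip: a_def)
  also have "\<dots> = (1 + a) / 2" using a by (simp add: field_simps)
  finally have n: "(norm (SU2_to_ball A))\<^sup>2 = (1 + a) / 2" .
  then show "norm (SU2_to_ball A) < 1"
    using a by (intro power2_less_imp_less[of _ 1]) auto
  have "sqrt (2 * (1 - a)) = 2 * sqrt (1 - (1 + a) / 2)"
  proof -
    have "2 * (1 - a) = 4 * (1 - (1 + a) / 2)" by (simp add: field_simps)
    then show ?thesis by (simp only: real_sqrt_mult real_sqrt_four)
  qed
  then have "2 * sqrt (1 - (1 + a) / 2) * (1 / sqrt (2 * (1 - a))) = 1"
    using a by simp
  moreover have two: "2 * ((1 + a) / 2) - 1 = a" by (simp add: field_simps)
  ultimately have "ball_to_SU2 (SU2_to_ball A) = quat a (im_part A)"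
    unfolding ball_to_SU2_def n two by (simp add: SU2_to_ball_def flip: a_def)
  then show "ball_to_SU2 (SU2_to_ball A) = A"
    using quat_parts[OF assms(1)] by (simp add: a_def)
qed

lemma continuous_on_ball_to_SU2: "continuous_on UNIV ball_to_SU2"
  unfolding ball_to_SU2_def by (intro continuous_intros)

text \<open>The largest norm of the first \<open>k\<close> vectors. In the polar coordinates of a cell the radius is measured with
  it, so that the whole boundary of the product of unit balls is at radius \<open>1\<close>.\<close>

primrec max_norm :: "nat \<Rightarrow> (nat \<Rightarrow> real^3) \<Rightarrow> real" where
  "max_norm 0 v = 0"
| "max_norm (Suc k) v = max (max_norm k v) (norm (v k))"

lemma norm_le_max_norm: "i < k \<Longrightarrow> norm (v i) \<le> max_norm k v"
  by (induction k) (auto simp: less_Suc_eq le_max_iff_disj)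

lemma max_norm_attained: "k \<ge> 1 \<Longrightarrow> \<exists>i<k. norm (v i) = max_norm k v"
proof (induction k)
  case (Suc k)
  show ?case
  proof (cases "k = 0 \<or> max_norm k v \<le> norm (v k)")
    case True
    then show ?thesis by (intro exI[of _ k]) (auto simp: max_def)
  next
    case False
    then show ?thesis using Suc by (force simp: less_Suc_eq max_def)
  qed
qed simp

lemma max_norm_scale: "0 \<le> c \<Longrightarrow> max_norm k (\<lambda>i. c *\<^sub>R v i) = c * max_norm k v"
  by (induction k) (auto simp: max_mult_distrib_left)

lemma max_norm_cong: "(\<And>i. i < k \<Longrightarrow> v i = v' i) \<Longrightarrow> max_norm k v = max_norm k v'"
  by (induction k) auto


section \<open>Cells, and the wedge of suspended sphere bundles\<close>

lemma compact_space_sum_topology: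
  assumes "finite I" "\<And>i. i \<in> I \<Longrightarrow> compact_space (X i)"
  shows "compact_space (sum_topology X I)"
proof -
  have "compactin (sum_topology X I) (\<Union>i\<in>I. (\<lambda>x. (i, x)) ` topspace (X i))"
  proof (rule compactin_Union)
    fix C assume "C \<in> (\<lambda>i. (\<lambda>x. (i, x)) ` topspace (X i)) ` I"
    then obtain i where "i \<in> I" "C = (\<lambda>x. (i, x)) ` topspace (X i)" by blast
    then show "compactin (sum_topology X I) C"
      using assms(2) image_compactin[OF _ continuous_map_component_injection]
      by (metis compact_space_def)
  qed (use assms(1) in simp)
  moreover have "(\<Union>i\<in>I. (\<lambda>x. (i, x)) ` topspace (X i)) = topspace (sum_topology X I)"
    by auto
  ultimately show ?thesis by (simp add: compact_space_def)
qed

lemma quotient_map_sum_topology: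
  assumes "\<And>i. i \<in> I \<Longrightarrow> quotient_map (X i) (Y i) (f i)"
  shows "quotient_map (sum_topology X I) (sum_topology Y I) (\<lambda>(i, x). (i, f i x))"
proof -
  have surj: "f i ` topspace (X i) = topspace (Y i)" if "i \<in> I" for i
    using assms[OF that] by (rule quotient_imp_surjective_map)
  show ?thesis
    unfolding quotient_map_def
  proof (intro conjI allI impI)
    show "(\<lambda>(i, x). (i, f i x)) ` topspace (sum_topology X I) = topspace (sum_topology Y I)"
      using surj by force
    fix U assume U: "U \<subseteq> topspace (sum_topology Y I)"
    let ?V = "{p \<in> topspace (sum_topology X I). (\<lambda>(i, x). (i, f i x)) p \<in> U}"
    have "openin (X i) {x. (i, x) \<in> ?V} \<longleftrightarrow> openin (Y i) {y. (i, y) \<in> U}" if i: "i \<in> I" for i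
    proof -
      have eq: "{x. (i, x) \<in> ?V} = {x \<in> topspace (X i). f i x \<in> {y. (i, y) \<in> U}}" using i by auto
      have "{y. (i, y) \<in> U} \<subseteq> topspace (Y i)" using U i by auto
      then show ?thesis
        using assms[OF i] unfolding quotient_map_def eq by blast
    qed
    moreover have "?V \<subseteq> Sigma I (topspace \<circ> X)" "U \<subseteq> Sigma I (topspace \<circ> Y)" using U by auto
    ultimately show "openin (sum_topology X I) ?V = openin (sum_topology Y I) U"
      unfolding openin_sum_topology by blast
  qed
qed

lemma quotient_map_wedge:
  "quotient_map (sum_topology X I) (wedge X p I) (\<lambda>z. wedge_rel X p I `` {z})"
  unfolding wedge_def quotient_space_def by (rule quotient_map_quotient_topology)

lemma wedge_class_eq_iff:
  assumes "i \<in> I" "j \<in> I" "x \<in> topspace (X i)" "y \<in> topspace (X j)"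
  shows "wedge_rel X p I `` {(i, x)} = wedge_rel X p I `` {(j, y)} \<longleftrightarrow>
    (i, x) = (j, y) \<or> x = p i \<and> y = p j"
proof -
  have "wedge_rel X p I `` {(i, x)} = wedge_rel X p I `` {(j, y)} \<longleftrightarrow> ((i, x), (j, y)) \<in> wedge_rel X p I"
    using assms by (intro eq_equiv_class_iff[OF equiv_wedge_rel]) auto
  then show ?thesis using assms by (simp add: wedge_rel_def)
qed

lemma same_fibres_imp_homeomorphic_space:
  assumes f: "quotient_map D A f" and g: "quotient_map D B g"
    and fg: "\<And>x y. \<lbrakk>x \<in> topspace D; y \<in> topspace D\<rbrakk> \<Longrightarrow> f x = f y \<longleftrightarrow> g x = g y"
  shows "A homeomorphic_space B"
proof -
  obtain h where h: "continuous_map A B h" "\<And>x. x \<in> topspace D \<Longrightarrow> h (f x) = g x"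
    by (rule quotient_map_lift_exists[OF f quotient_imp_continuous_map[OF g]]) (use fg in blast)+
  obtain k where k: "continuous_map B A k" "\<And>x. x \<in> topspace D \<Longrightarrow> k (g x) = f x"
    by (rule quotient_map_lift_exists[OF g quotient_imp_continuous_map[OF f]]) (use fg in blast)+
  have "homeomorphic_maps A B h k"
    unfolding homeomorphic_maps_def
    using h k quotient_imp_surjective_map[OF f, symmetric] quotient_imp_surjective_map[OF g, symmetric] by auto
  then show ?thesis by (auto simp: homeomorphic_space_def)
qed

lemma sus_eq_suspension_point_iff:
  assumes "x \<in> topspace X" "t \<in> {0..1}"
  shows "sus X x t = suspension_point X \<longleftrightarrow> t = 0"
proof -
  have "sus X x 0 = suspension_point X"
    using assms by (auto simp: sus_def suspension_rel_def suspension_point_def)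
  then show ?thesis using sus_eq_iff[of x X x t 0] assms by auto
qed

lemma taut_sphere_bundle_iff:
  "(l, v) \<in> topspace (taut_sphere_bundle k) \<longleftrightarrow>
     (\<exists>u. norm u = 1 \<and> l = span {u}) \<and> v \<in> extensional {..<k} \<and> (\<forall>i<k. v i \<in> l) \<and>
     (\<Sum>i<k. (norm (v i))\<^sup>2) = 1"
  by (auto simp: taut_sphere_bundle_def taut_sum_def taut_line_bundle_def RP2_def PiE_def)

lemma quotient_map_RP2: "quotient_map (top_of_set (sphere 0 1)) RP2 (\<lambda>x. span {x})"
  unfolding RP2_def by (rule quotient_map_quotient_topology)

lemma compact_space_taut_sphere_bundle: "compact_space (taut_sphere_bundle k)"
proof -
  \<comment> \<open>The bundle is the image of the compact space of pairs of a unit vector \<open>u\<close> and a unit vector \<open>c\<close> of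
      coefficients, under the map to the line of \<open>u\<close> and the vectors \<open>c i u\<close>.\<close>
  define C where "C = {c \<in> topspace (product_topology (\<lambda>_. top_of_set {-1..1::real}) {..<k}). (\<Sum>i<k. (c i)\<^sup>2) \<in> {1}}"
  define K where "K = subtopology (product_topology (\<lambda>_. top_of_set {-1..1::real}) {..<k}) C"
  have comp: "continuous_map (product_topology (\<lambda>_. top_of_set {-1..1::real}) {..<k}) euclideanreal (\<lambda>c. c i)" if "i < k" for i
    using continuous_map_product_projection[of i "{..<k}" "\<lambda>_. top_of_set {-1..1::real}"] that
    by (auto intro: continuous_map_into_fulltopology)
  have "continuous_map (product_topology (\<lambda>_. top_of_set {-1..1::real}) {..<k}) euclideanreal (\<lambda>c. \<Sum>i<k. (c i)\<^sup>2)"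
    by (intro continuous_map_sum continuous_map_real_pow comp) auto
  then have "closedin (product_topology (\<lambda>_. top_of_set {-1..1::real}) {..<k}) C"
    unfolding C_def by (rule closedin_continuous_map_preimage) auto
  moreover have "compact_space (product_topology (\<lambda>_. top_of_set {-1..1::real}) {..<k})"
    by (auto simp: compact_space_product_topology compact_space_subtopology)
  ultimately have "compact_space K"
    unfolding K_def by (intro compact_space_subtopology closedin_compact_space)
  define P where "P = prod_topology (top_of_set (sphere (0::real^3) 1)) K"
  have "compact_space P"
    unfolding P_def using \<open>compact_space K\<close> by (simp add: compact_space_prod_topology compact_space_subtopology)
  have topK: "topspace K = {c \<in> {..<k} \<rightarrow>\<^sub>E {-1..1}. (\<Sum>i<k. (c i)\<^sup>2) = 1}"
    by (auto simp: K_def C_def)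
  define f :: "(real^3) \<times> (nat \<Rightarrow> real) \<Rightarrow> (real^3) set \<times> (nat \<Rightarrow> real^3)"
    where "f = (\<lambda>(u, c). (span {u}, \<lambda>i\<in>{..<k}. c i *\<^sub>R u))"
  have f_in: "f p \<in> topspace (taut_sphere_bundle k)" if "p \<in> topspace P" for p
    using that by (cases p) (auto simp: P_def topK f_def taut_sphere_bundle_iff span_breakdown_eq
        power_mult_distrib intro!: span_mul span_base)
  have c1: "continuous_map P RP2 (\<lambda>p. span {fst p})"
    using continuous_map_compose[OF continuous_map_fst quotient_imp_continuous_map[OF quotient_map_RP2]]
    by (simp add: P_def o_def)
  have cu: "continuous_map P euclidean fst"
    unfolding P_def by (rule continuous_map_into_fulltopology[OF continuous_map_fst])
  have cK: "continuous_map P K snd"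
    unfolding P_def by (rule continuous_map_snd)
  have cc: "continuous_map P euclideanreal (\<lambda>p. snd p i)" if "i < k" for i
    using continuous_map_compose[OF cK[unfolded K_def, THEN continuous_map_into_fulltopology] comp[OF that]]
    by (simp add: o_def)
  have cv: "continuous_map P euclidean (\<lambda>p. snd p i *\<^sub>R fst p)" if "i < k" for i
    using cu cc[OF that] by (simp add: continuous_map_atin tendsto_scaleR)
  have "continuous_map P (product_topology (\<lambda>_. euclidean) {..<k}) (\<lambda>p. \<lambda>i\<in>{..<k}. snd p i *\<^sub>R fst p)"
    unfolding continuous_map_componentwise using cv by auto
  then have "continuous_map P (prod_topology RP2 (product_topology (\<lambda>_. euclidean) {..<k})) f"
    using c1 by (simp add: continuous_map_pairwise o_def f_def case_prod_unfold)
  then have cf: "continuous_map P (taut_sphere_bundle k) f"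
    using f_in unfolding taut_sphere_bundle_def taut_sum_def
    by (auto simp: continuous_map_in_subtopology)
  have "topspace (taut_sphere_bundle k) \<subseteq> f ` topspace P"
  proof
    fix p assume p: "p \<in> topspace (taut_sphere_bundle k)"
    obtain l v where lv: "p = (l, v)" by (metis surj_pair)
    obtain u where u: "norm u = 1" "l = span {u}"
      and v: "v \<in> extensional {..<k}" "\<forall>i<k. v i \<in> l" "(\<Sum>i<k. (norm (v i))\<^sup>2) = 1"
      using p by (auto simp: lv taut_sphere_bundle_iff)
    have "\<forall>i<k. \<exists>c. v i = c *\<^sub>R u" using v(2) u(2) by (auto simp: span_singleton)
    then obtain c where c: "\<And>i. i < k \<Longrightarrow> v i = c i *\<^sub>R u" by metis
    have sq: "(\<Sum>i<k. (c i)\<^sup>2) = 1" using v(3) c u(1) by simp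
    have "c i \<in> {-1..1}" if "i < k" for i
    proof -
      have "(c i)\<^sup>2 \<le> (\<Sum>i<k. (c i)\<^sup>2)" using that by (intro member_le_sum) auto
      then show ?thesis using sq by (simp add: abs_le_iff abs_square_le_1)
    qed
    then have "(u, \<lambda>i\<in>{..<k}. c i) \<in> topspace P"
      using u(1) sq by (auto simp: P_def topK)
    moreover have "f (u, \<lambda>i\<in>{..<k}. c i) = p"
      using c v(1) u(2) by (auto simp: f_def lv fun_eq_iff extensional_def restrict_def)
    ultimately show "p \<in> f ` topspace P" by force
  qed
  then have "topspace (taut_sphere_bundle k) = f ` topspace P" using f_in by blast
  then show ?thesis
    using image_compactin[OF _ cf, of "topspace P"] \<open>compact_space P\<close> by (simp add: compact_space_def)
qed

lemma sphere_bundle_max_norm: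
  assumes "(l, v) \<in> topspace (taut_sphere_bundle k)"
  shows "0 < max_norm k v" "k \<ge> 1"
proof -
  have "\<exists>i<k. v i \<noteq> 0"
  proof (rule ccontr)
    assume "\<not> ?thesis"
    then have "(\<Sum>i<k. (norm (v i))\<^sup>2) = 0" by simp
    then show False using assms by (simp add: taut_sphere_bundle_iff)
  qed
  then obtain i where "i < k" "v i \<noteq> 0" by blast
  then show "0 < max_norm k v" "k \<ge> 1"
    using norm_le_max_norm[of i k v] zero_less_norm_iff[of "v i"] by linarith+
qed

text \<open>The cell of \<open>T\<close> in polar coordinates: direction \<open>v\<close> in \<open>S(kL)\<close>, and radius \<open>1 - t\<close>. So \<open>t = 0\<close> is the
  collapsed boundary (the base point of the suspension), and \<open>t = 1\<close> is the centre. The map \<open>r\<close>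
  numbers the elements of \<open>T\<close>.\<close>

definition cell :: "nat \<Rightarrow> nat set \<Rightarrow> (nat \<Rightarrow> nat) \<Rightarrow> nat \<Rightarrow> (nat \<Rightarrow> real^3) \<Rightarrow> real \<Rightarrow> nat \<Rightarrow> complex^2^2" where
  "cell n T r k v t =
     (\<lambda>j\<in>{..<n}. if j \<in> T then ball_to_SU2 (((1 - t) / max_norm k v) *\<^sub>R v (r j)) else mat 1)"

locale cell_index =
  fixes n k :: nat and T :: "nat set" and r :: "nat \<Rightarrow> nat"
  assumes T: "T \<subseteq> {..<n}" and r: "bij_betw r T {..<k}"
begin

lemma r_less: "j \<in> T \<Longrightarrow> r j < k"
  using r by (auto simp: bij_betw_def)

lemma r_surj: "i < k \<Longrightarrow> \<exists>j\<in>T. r j = i"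
  using r unfolding bij_betw_def by (metis imageE lessThan_iff)

lemma norm_le:
  assumes "(l, v) \<in> topspace (taut_sphere_bundle k)" "t \<in> {0..1}" "j \<in> T"
  shows "norm (((1 - t) / max_norm k v) *\<^sub>R v (r j)) \<le> 1 - t"
proof -
  have "norm (v (r j)) \<le> max_norm k v" by (rule norm_le_max_norm[OF r_less[OF assms(3)]])
  then show ?thesis
    using sphere_bundle_max_norm(1)[OF assms(1)] assms(2)
    by (simp add: divide_le_eq mult_left_mono)
qed

lemma cell_in:
  assumes lv: "(l, v) \<in> topspace (taut_sphere_bundle k)" and t: "t \<in> {0..1}"
  shows "cell n T r k v t \<in> topspace (commuting_tuples n)"
proof -
  define w where "w = (\<lambda>j. ((1 - t) / max_norm k v) *\<^sub>R v (r j))"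
  have w: "norm (w j) \<le> 1" if "j \<in> T" for j
    using norm_le[OF lv t that] t unfolding w_def by simp
  then have SU: "ball_to_SU2 (w j) \<in> SU2" if "j \<in> T" for j
    using that by (simp add: ball_to_SU2_in)
  obtain u where u: "\<And>i. i < k \<Longrightarrow> v i \<in> span {u}"
    using lv by (auto simp: taut_sphere_bundle_iff)
  have comm: "ball_to_SU2 (w i) ** ball_to_SU2 (w j) = ball_to_SU2 (w j) ** ball_to_SU2 (w i)"
    if ij: "i \<in> T" "j \<in> T" for i j
  proof -
    obtain c d where "v (r i) = c *\<^sub>R u" "v (r j) = d *\<^sub>R u"
      using u[OF r_less[OF ij(1)]] u[OF r_less[OF ij(2)]] unfolding span_singleton by blast
    then show ?thesis
      by (simp add: ball_to_SU2_def quat_commute_iff w_def cross_mult_left cross_mult_right)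
  qed
  have "cell n T r k v t = (\<lambda>j\<in>{..<n}. if j \<in> T then ball_to_SU2 (w j) else mat 1)"
    unfolding cell_def w_def ..
  then show ?thesis
    using SU comm one_in_SU2 by (auto simp: topspace_commuting_tuples)
qed

lemma cell_ne_one:
  assumes "(l, v) \<in> topspace (taut_sphere_bundle k)" "t \<in> {0<..1}" "j \<in> T"
  shows "cell n T r k v t j \<noteq> mat 1"
proof -
  define w where "w = ((1 - t) / max_norm k v) *\<^sub>R v (r j)"
  have "norm w \<le> 1 - t" unfolding w_def by (rule norm_le[OF assms(1) _ assms(3)]) (use assms(2) in auto)
  then have "ball_to_SU2 w \<noteq> mat 1" using ball_to_SU2_eq_one_iff[of w] assms(2) by auto
  moreover have "cell n T r k v t j = ball_to_SU2 w" using T assms(3) by (auto simp: cell_def w_def)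
  ultimately show ?thesis by simp
qed

lemma cell_0_eq_one:
  assumes "(l, v) \<in> topspace (taut_sphere_bundle k)"
  shows "\<exists>j\<in>T. cell n T r k v 0 j = mat 1"
proof -
  obtain i where i: "i < k" "norm (v i) = max_norm k v"
    using max_norm_attained sphere_bundle_max_norm(2)[OF assms] by blast
  obtain j where j: "j \<in> T" "r j = i" using r_surj[OF i(1)] by blast
  have "norm ((1 / max_norm k v) *\<^sub>R v (r j)) = 1"
    using i j sphere_bundle_max_norm(1)[OF assms] by simp
  then show ?thesis
    using j T ball_to_SU2_eq_one_iff[of "(1 / max_norm k v) *\<^sub>R v (r j)"]
    by (intro bexI[OF _ j(1)]) (auto simp: cell_def subset_iff)
qed

lemma collapse_cell:
  assumes "(l, v) \<in> topspace (taut_sphere_bundle k)" "t \<in> {0..1}"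
  shows "collapse n (T, cell n T r k v t) = (if t = 0 then one_tuple n else cell n T r k v t)"
  using cell_0_eq_one[OF assms(1)] cell_ne_one[OF assms(1), of t] assms(2)
  by (auto simp: collapse_def)

lemma cell_inj:
  assumes lv: "(l, v) \<in> topspace (taut_sphere_bundle k)" "t \<in> {0<..1}"
    and lv': "(l', v') \<in> topspace (taut_sphere_bundle k)" "t' \<in> {0<..1}"
    and eq: "cell n T r k v t = cell n T r k v' t'"
  shows "t = t' \<and> ((l, v) = (l', v') \<or> t = 1)"
proof -
  define a where "a = (1 - t) / max_norm k v"
  define a' where "a' = (1 - t') / max_norm k v'"
  have pos: "0 < max_norm k v" "0 < max_norm k v'"
    using sphere_bundle_max_norm lv lv' by blast+
  have a0: "0 \<le> a" "0 \<le> a'" using pos lv lv' by (auto simp: a_def a'_def)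
  have w: "a *\<^sub>R v i = a' *\<^sub>R v' i" if i: "i < k" for i
  proof -
    obtain j where j: "j \<in> T" "r j = i" using r_surj[OF i] by blast
    have "ball_to_SU2 (a *\<^sub>R v i) = ball_to_SU2 (a' *\<^sub>R v' i)"
      using fun_cong[OF eq, of j] j T by (auto simp: cell_def a_def a'_def subset_iff)
    moreover have "norm (a *\<^sub>R v i) < 1"
      using norm_le[OF lv(1), of t j] j lv(2) by (simp add: a_def)
    ultimately show ?thesis by (intro ball_to_SU2_inj)
  qed
  have "a * max_norm k v = max_norm k (\<lambda>i. a *\<^sub>R v i)" using a0 by (simp add: max_norm_scale)
  also have "\<dots> = max_norm k (\<lambda>i. a' *\<^sub>R v' i)" using w by (intro max_norm_cong)
  also have "\<dots> = a' * max_norm k v'" using a0 by (simp add: max_norm_scale)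
  finally have tt: "t = t'" using pos by (simp add: a_def a'_def)
  have "(l, v) = (l', v')" if "t \<noteq> 1"
  proof -
    have a: "0 < a" "0 < a'" using that tt pos lv lv' by (auto simp: a_def a'_def)
    have "a\<^sup>2 * (\<Sum>i<k. (norm (v i))\<^sup>2) = (\<Sum>i<k. (norm (a *\<^sub>R v i))\<^sup>2)"
      by (simp add: power_mult_distrib sum_distrib_left)
    also have "\<dots> = (\<Sum>i<k. (norm (a' *\<^sub>R v' i))\<^sup>2)" using w by simp
    also have "\<dots> = a'\<^sup>2 * (\<Sum>i<k. (norm (v' i))\<^sup>2)"
      by (simp add: power_mult_distrib sum_distrib_left)
    finally have "a\<^sup>2 = a'\<^sup>2" using lv lv' by (simp add: taut_sphere_bundle_iff)
    then have "a = a'" using a by (simp add: power2_eq_iff_nonneg)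
    then have vi: "v i = v' i" if "i < k" for i using w[OF that] a by simp
    then have vv: "v = v'"
      using lv lv' by (intro extensionalityI[of v "{..<k}" v']) (auto simp: taut_sphere_bundle_iff)
    obtain u u' where u: "l = span {u}" "l' = span {u'}"
      using lv lv' by (auto simp: taut_sphere_bundle_iff)
    have "\<exists>i<k. v i \<noteq> 0"
      using max_norm_attained[of k v] sphere_bundle_max_norm[OF lv(1)] by (metis less_irrefl norm_zero)
    then obtain i where i: "i < k" "v i \<noteq> 0" by blast
    have line: "span {v i} = span {x}" if x: "v i \<in> span {x}" for x
    proof -
      obtain c where c: "v i = c *\<^sub>R x" using x by (auto simp: span_singleton)
      then have "x = (1 / c) *\<^sub>R v i" using i by auto
      then have "x \<in> span {v i}" by (metis span_base span_mul singletonI)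
      then show ?thesis using x by (intro subset_antisym span_minimal) auto
    qed
    have "v i \<in> l" "v i \<in> l'"
      using lv lv' i vv by (auto simp: taut_sphere_bundle_iff)
    then have "l = l'" using line u by metis
    with vv show ?thesis by simp
  qed
  with tt show ?thesis by blast
qed

lemma cell_surj:
  assumes g: "g \<in> topspace (commuting_tuples n)" and supp: "T = {j. j < n \<and> g j \<noteq> mat 1}" and k: "k \<ge> 1"
  shows "\<exists>l v t. (l, v) \<in> topspace (taut_sphere_bundle k) \<and> t \<in> {0<..1} \<and> cell n T r k v t = g"
proof -
  define w where "w = (\<lambda>i. SU2_to_ball (g (inv_into T r i)))"
  have inv: "inv_into T r i \<in> T" "r (inv_into T r i) = i" if "i < k" for i
    using r that by (auto simp: bij_betw_def inv_into_into f_inv_into_f)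
  have w_r: "w (r j) = SU2_to_ball (g j)" if "j \<in> T" for j
    using r that by (auto simp: bij_betw_def w_def)
  have gT: "g j \<in> SU2 \<and> g j \<noteq> mat 1" if "j \<in> T" for j
    using that g supp by (auto intro: tuple_in_SU2)
  have w1: "norm (w i) < 1" if "i < k" for i
    unfolding w_def using gT[OF inv(1)[OF that]] by (simp add: ball_to_SU2_surj)
  have gw: "ball_to_SU2 (w (r j)) = g j" if "j \<in> T" for j
    using gT[OF that] by (simp add: w_r[OF that] ball_to_SU2_surj)
  have cellI: "cell n T r k v t = g"
    if "\<And>i. i < k \<Longrightarrow> ((1 - t) / max_norm k v) *\<^sub>R v i = w i" for v t
  proof
    fix j
    show "cell n T r k v t j = g j"
    proof (cases "j \<in> T")
      case True
      then show ?thesis using that[OF r_less[OF True]] gw[OF True] T by (auto simp: cell_def)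
    next
      case False
      then show ?thesis using g supp
        by (auto simp: cell_def topspace_commuting_tuples PiE_def extensional_def restrict_def)
    qed
  qed
  have cross: "cross3 (w i) (w j) = 0" if "i < k" "j < k" for i j
  proof -
    let ?i = "inv_into T r i" and ?j = "inv_into T r j"
    have "?i < n" "?j < n" using inv that T by auto
    then have "g ?i ** g ?j = g ?j ** g ?i" "g ?i \<in> SU2" "g ?j \<in> SU2"
      using g by (auto simp: topspace_commuting_tuples)
    then have "cross3 (im_part (g ?i)) (im_part (g ?j)) = 0" using SU2_commute_iff by blast
    then show ?thesis by (simp add: w_def SU2_to_ball_def cross_mult_left cross_mult_right)
  qed
  show ?thesis
  proof (cases "\<forall>i<k. w i = 0")
    case True
    define e :: "real^3" where "e = axis 1 1"
    define v where "v = (\<lambda>i\<in>{..<k}. if i = 0 then e else 0)"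
    have "norm e = 1" by (simp add: e_def)
    moreover have "(\<Sum>i<k. (norm (v i))\<^sup>2) = (\<Sum>i<k. if i = 0 then 1 else 0)"
      by (intro sum.cong) (auto simp: v_def \<open>norm e = 1\<close>)
    moreover have "(\<Sum>i<k. if i = 0 then 1 else 0) = (1::real)" using k by simp
    ultimately have "(span {e}, v) \<in> topspace (taut_sphere_bundle k)"
      by (auto simp: taut_sphere_bundle_iff v_def span_base span_zero)
    moreover have "cell n T r k v 1 = g" by (rule cellI) (use True in simp)
    ultimately show ?thesis by (intro exI[of _ "span {e}"] exI[of _ v] exI[of _ 1]) auto
  next
    case False
    then obtain i0 where i0: "i0 < k" "w i0 \<noteq> 0" by blast
    define M where "M = max_norm k w"
    define N where "N = sqrt (\<Sum>i<k. (norm (w i))\<^sup>2)"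
    define v where "v = (\<lambda>i\<in>{..<k}. (1 / N) *\<^sub>R w i)"
    have M: "0 < M" "M < 1"
    proof -
      show "0 < M" using norm_le_max_norm[OF i0(1), of w] i0(2) unfolding M_def
        by (metis less_le_trans zero_less_norm_iff)
      obtain i where "i < k" "norm (w i) = M"
        using max_norm_attained[OF k, of w] unfolding M_def by blast
      then show "M < 1" using w1[of i] by simp
    qed
    have "(norm (w i0))\<^sup>2 \<le> (\<Sum>i<k. (norm (w i))\<^sup>2)" using i0 by (intro member_le_sum) auto
    moreover have "0 < (norm (w i0))\<^sup>2" using i0 by simp
    ultimately have pos: "0 < (\<Sum>i<k. (norm (w i))\<^sup>2)" by linarith
    then have N: "0 < N" "N\<^sup>2 = (\<Sum>i<k. (norm (w i))\<^sup>2)" by (simp_all add: N_def)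
    have "(\<Sum>i<k. (norm (v i))\<^sup>2) = (\<Sum>i<k. (norm (w i))\<^sup>2 / N\<^sup>2)"
      by (intro sum.cong) (auto simp: v_def power_divide)
    also have "\<dots> = 1" using pos N by (simp flip: sum_divide_distrib)
    finally have sum1: "(\<Sum>i<k. (norm (v i))\<^sup>2) = 1" .
    define u where "u = (1 / norm (w i0)) *\<^sub>R w i0"
    have u: "norm u = 1" using i0 by (simp add: u_def)
    have "w i \<in> span {u}" if "i < k" for i
    proof -
      have "collinear {0, w i0, w i}" using cross[OF i0(1) that] by (simp add: cross_eq_0)
      then obtain c where c: "w i = c *\<^sub>R w i0" using i0(2) by (auto simp: collinear_lemma)
      also have "\<dots> = (c * norm (w i0)) *\<^sub>R u" using i0(2) by (simp add: u_def)
      finally show ?thesis unfolding span_singleton by (rule image_eqI) simp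
    qed
    then have "v i \<in> span {u}" if "i < k" for i
      using that by (simp add: v_def span_mul)
    then have lv: "(span {u}, v) \<in> topspace (taut_sphere_bundle k)"
      using u sum1 by (auto simp: taut_sphere_bundle_iff v_def)
    have "max_norm k v = max_norm k (\<lambda>i. (1 / N) *\<^sub>R w i)"
      by (intro max_norm_cong) (simp add: v_def)
    also have "\<dots> = M / N" using N by (simp add: max_norm_scale M_def)
    finally have "cell n T r k v (1 - M) = g"
      using M N by (intro cellI) (simp add: v_def)
    then show ?thesis using lv M by (intro exI[of _ "span {u}"] exI[of _ v] exI[of _ "1 - M"]) auto
  qed
qed

lemma continuous_map_cell:
  "continuous_map (prod_topology (taut_sphere_bundle k) (top_of_set {0..1})) (commuting_tuples n)
     (\<lambda>((l, v), t). cell n T r k v t)"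
proof (rule continuous_map_into_commuting_tuples)
  let ?P = "prod_topology (taut_sphere_bundle k) (top_of_set {0..1::real})"
  show "(case p of (x, t) \<Rightarrow> (case x of (l, v) \<Rightarrow> \<lambda>t. cell n T r k v t) t) \<in> topspace (commuting_tuples n)"
    if "p \<in> topspace ?P" for p
    using that cell_in by (auto split: prod.splits)
  fix j assume j: "j < n"
  have cP: "continuous_map ?P (taut_sphere_bundle k) fst" by (rule continuous_map_fst)
  have ct: "continuous_map ?P euclideanreal snd" by (rule continuous_map_into_fulltopology[OF continuous_map_snd])
  have "continuous_map (taut_sphere_bundle k) (product_topology (\<lambda>_. euclidean) {..<k}) snd"
    unfolding taut_sphere_bundle_def taut_sum_def
    by (intro continuous_map_from_subtopology continuous_map_snd)
  from continuous_map_compose[OF cP this]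
  have cv: "continuous_map ?P (product_topology (\<lambda>_. euclidean) {..<k}) (\<lambda>p. snd (fst p))" by (simp add: o_def)
  have cvi: "continuous_map ?P euclidean (\<lambda>p. snd (fst p) i)" if "i < k" for i
    using cv that by (auto simp: continuous_map_componentwise)
  have "continuous_map ?P euclideanreal (\<lambda>p. max_norm m (snd (fst p)))" if "m \<le> k" for m
    using that
  proof (induction m)
    case (Suc m)
    then show ?case using cvi[of m] by (auto intro!: continuous_intros)
  qed simp
  then have cm: "continuous_map ?P euclideanreal (\<lambda>p. max_norm k (snd (fst p)))" by simp
  show "continuous_map ?P euclidean (\<lambda>p. (case p of (x, t) \<Rightarrow> (case x of (l, v) \<Rightarrow> \<lambda>t. cell n T r k v t) t) j)"
  proof (cases "j \<in> T")
    case False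
    then show ?thesis using j by (simp add: cell_def case_prod_unfold)
  next
    case True
    have nz: "max_norm k (snd (fst p)) \<noteq> 0" if "p \<in> topspace ?P" for p
      using that sphere_bundle_max_norm(1)[of "fst (fst p)" "snd (fst p)" k] by auto
    have "continuous_map ?P euclideanreal (\<lambda>p. (1 - snd p) / max_norm k (snd (fst p)))"
      by (intro continuous_intros ct cm nz)
    then have "continuous_map ?P euclidean (\<lambda>p. ((1 - snd p) / max_norm k (snd (fst p))) *\<^sub>R snd (fst p) (r j))"
      using cvi[OF r_less[OF True]] by (simp add: continuous_map_atin tendsto_scaleR)
    moreover have "continuous_map euclidean euclidean ball_to_SU2"
      using continuous_on_ball_to_SU2 by simp
    ultimately have "continuous_map ?P euclidean
        (\<lambda>p. ball_to_SU2 (((1 - snd p) / max_norm k (snd (fst p))) *\<^sub>R snd (fst p) (r j)))"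
      using continuous_map_compose[of ?P euclidean _ euclidean ball_to_SU2] by (simp add: o_def)
    then show ?thesis using j True by (simp add: cell_def case_prod_unfold)
  qed
qed

end

lemma ex_subset_enumeration:
  "\<exists>T r. bij_betw T (SIGMA k:{1..n}. {..<n choose k}) {A. A \<subseteq> {..<n} \<and> A \<noteq> {}} \<and>
     (\<forall>k\<in>{1..n}. \<forall>j<n choose k. bij_betw (r (k, j)) (T (k, j)) {..<k})"
proof -
  have "\<exists>h. bij_betw h {..<n choose k} {A. A \<subseteq> {..<n} \<and> card A = k}" for k
    using ex_bij_betw_nat_finite[of "{A. A \<subseteq> {..<n} \<and> card A = k}"] n_subsets[of "{..<n}" k]
    by (simp add: atLeast0LessThan)
  then obtain h where h: "\<And>k. bij_betw (h k) {..<n choose k} {A. A \<subseteq> {..<n} \<and> card A = k}" by metis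
  define T where "T = (\<lambda>(k, j). h k j)"
  have hk: "h k j \<subseteq> {..<n} \<and> card (h k j) = k" if "j < n choose k" for k j
    using h[of k] that by (auto simp: bij_betw_def)
  have inj: "k = k' \<and> j = j'" if "j < n choose k" "j' < n choose k'" "h k j = h k' j'" for k j k' j'
  proof -
    have "k = k'" using hk that by metis
    then show ?thesis using that h[of k] by (auto simp: bij_betw_def inj_on_def)
  qed
  have "bij_betw T (SIGMA k:{1..n}. {..<n choose k}) {A. A \<subseteq> {..<n} \<and> A \<noteq> {}}"
    unfolding bij_betw_def
  proof
    show "inj_on T (SIGMA k:{1..n}. {..<n choose k})"
      using inj by (auto simp: inj_on_def T_def)
    show "T ` (SIGMA k:{1..n}. {..<n choose k}) = {A. A \<subseteq> {..<n} \<and> A \<noteq> {}}"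
    proof
      show "T ` (SIGMA k:{1..n}. {..<n choose k}) \<subseteq> {A. A \<subseteq> {..<n} \<and> A \<noteq> {}}"
        using hk by (fastforce simp: T_def)
      show "{A. A \<subseteq> {..<n} \<and> A \<noteq> {}} \<subseteq> T ` (SIGMA k:{1..n}. {..<n choose k})"
      proof
        fix A assume A: "A \<in> {A. A \<subseteq> {..<n} \<and> A \<noteq> {}}"
        then have "finite A" using finite_subset by blast
        then have "card A \<in> {1..n}" using A card_mono[of "{..<n}" A] by (auto simp: Suc_le_eq card_gt_0_iff)
        moreover obtain j where "j < n choose card A" "A = h (card A) j"
          using h[of "card A"] A unfolding bij_betw_def by blast
        ultimately show "A \<in> T ` (SIGMA k:{1..n}. {..<n choose k})"
          by (intro image_eqI[of _ _ "(card A, j)"]) (auto simp: T_def)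
      qed
    qed
  qed
  moreover have "\<exists>f. bij_betw f (T (k, j)) {..<k}" if "j < n choose k" for k j
  proof -
    have "finite (T (k, j))" "card (T (k, j)) = k"
      using hk[OF that] finite_subset[of "h k j" "{..<n}"] by (auto simp: T_def)
    then show ?thesis using ex_bij_betw_finite_nat[of "T (k, j)"] by (simp add: atLeast0LessThan)
  qed
  then have some: "bij_betw (SOME f. bij_betw f (T (k, j)) {..<k}) (T (k, j)) {..<k}" if "j < n choose k" for k j
    using that by (metis (mono_tags, lifting) someI_ex)
  define r where "r = (\<lambda>p. SOME f. bij_betw f (T p) {..<fst p})"
  have "\<forall>k\<in>{1..n}. \<forall>j<n choose k. bij_betw (r (k, j)) (T (k, j)) {..<k}"
    using some by (simp add: r_def)
  ultimately show ?thesis by blast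
qed

text \<open>Both spaces are quotients of the disjoint union of the cylinders over the sphere bundles, with the same
  fibres. For the stage this holds since the union is compact and the stage is Hausdorff.\<close>

lemma last_stage_homeomorphic_wedge:
  assumes n: "n \<ge> 1"
  shows "stage n n homeomorphic_space
      wedge (\<lambda>(k, j). suspension (taut_sphere_bundle k))
             (\<lambda>(k, j). suspension_point (taut_sphere_bundle k))
             (SIGMA k:{1..n}. {..<n choose k})"
    (is "_ homeomorphic_space wedge ?X ?p ?I")
proof -
  obtain T r where T: "bij_betw T ?I {A. A \<subseteq> {..<n} \<and> A \<noteq> {}}"
    and r: "\<forall>k\<in>{1..n}. \<forall>j<n choose k. bij_betw (r (k, j)) (T (k, j)) {..<k}"
    using ex_subset_enumeration by blast
  have idx: "cell_index n (fst i) (T i) (r i)" if "i \<in> ?I" for i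
  proof
    show "T i \<subseteq> {..<n}" using T that by (auto simp: bij_betw_def)
    show "bij_betw (r i) (T i) {..<fst i}" using r that by (cases i) auto
  qed
  have finI: "finite ?I" by auto
  define B :: "nat \<times> nat \<Rightarrow> (((real^3) set \<times> (nat \<Rightarrow> real^3)) \<times> real) topology"
    where "B = (\<lambda>i. prod_topology (taut_sphere_bundle (fst i)) (top_of_set {0..1}))"
  define D where "D = sum_topology B ?I"
  have top_D: "(i, (l, v), t) \<in> topspace D \<longleftrightarrow>
      i \<in> ?I \<and> (l, v) \<in> topspace (taut_sphere_bundle (fst i)) \<and> t \<in> {0..1}" for i l v t
    by (cases i) (auto simp: D_def B_def)
  have compD: "compact_space D"
    unfolding D_def B_def
    by (rule compact_space_sum_topology[OF finI])
      (simp add: compact_space_prod_topology compact_space_taut_sphere_bundle compact_space_subtopology)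
  define f where "f = (\<lambda>(i, (l :: (real^3) set, v), t). collapse n (T i, cell n (T i) (r i) (fst i) v t))"
  define g where "g = (\<lambda>(i, x, t). wedge_rel ?X ?p ?I `` {(i, sus (taut_sphere_bundle (fst i)) x t)})"

  have f_eq: "f (i, (l, v), t) = (if t = 0 then one_tuple n else cell n (T i) (r i) (fst i) v t)"
    if "(i, (l, v), t) \<in> topspace D" for i l v t
  proof -
    have "i \<in> ?I" "(l, v) \<in> topspace (taut_sphere_bundle (fst i))" "t \<in> {0..1}"
      using that by (simp_all only: top_D)
    from cell_index.collapse_cell[OF idx[OF this(1)] this(2,3)] show ?thesis
      by (simp only: f_def case_prod_conv)
  qed
  have supp: "{j. j < n \<and> cell n (T i) (r i) (fst i) v t j \<noteq> mat 1} = T i"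
    if "(i, (l, v), t) \<in> topspace D" "t \<noteq> 0" for i l v t
  proof -
    have "i \<in> ?I" "(l, v) \<in> topspace (taut_sphere_bundle (fst i))" "t \<in> {0<..1}"
      using that by (auto simp: top_D)
    then have "\<forall>j\<in>T i. cell n (T i) (r i) (fst i) v t j \<noteq> mat 1" "T i \<subseteq> {..<n}"
      using cell_index.cell_ne_one[OF idx] cell_index.T[OF idx] by blast+
    then show ?thesis by (auto simp: cell_def)
  qed
  have Tne: "T i \<noteq> {}" if "i \<in> ?I" for i using T that by (auto simp: bij_betw_def)
  have one_supp: "{j. j < n \<and> one_tuple n j \<noteq> mat 1} = {}" by auto

  have "continuous_map D (stage n n) f"
    unfolding D_def continuous_map_from_sum_topology
  proof
    fix i assume i: "i \<in> ?I"
    have "continuous_map (B i) (pieces n n) (\<lambda>x. (T i, (\<lambda>((l, v), t). cell n (T i) (r i) (fst i) v t) x))"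
      unfolding B_def
      using cell_index.T[OF idx[OF i]] cell_index.continuous_map_cell[OF idx[OF i]]
      by (rule continuous_map_into_pieces) (auto simp: cell_def split: prod.splits)
    from continuous_map_compose[OF this quotient_imp_continuous_map[OF quotient_map_collapse]]
    show "continuous_map (B i) (stage n n) (\<lambda>x. f (i, x))"
      by (simp add: f_def o_def case_prod_unfold)
  qed
  moreover have "f ` topspace D = topspace (stage n n)"
  proof
    show "f ` topspace D \<subseteq> topspace (stage n n)"
      using calculation by (rule continuous_map_image_subset_topspace)
    show "topspace (stage n n) \<subseteq> f ` topspace D"
    proof
      fix y assume "y \<in> topspace (stage n n)"
      then have y: "y \<in> topspace (commuting_tuples n)" by (simp add: topspace_stage)
      let ?A = "{j. j < n \<and> y j \<noteq> mat 1}"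
      show "y \<in> f ` topspace D"
      proof (cases "?A = {}")
        case True
        then have y1: "y = one_tuple n"
          using y by (auto simp: topspace_commuting_tuples PiE_def extensional_def one_tuple_def fun_eq_iff)
        define e :: "real^3" where "e = axis 1 1"
        have "(span {e}, \<lambda>i\<in>{..<1}. e) \<in> topspace (taut_sphere_bundle 1)"
          by (auto simp: taut_sphere_bundle_iff span_base e_def intro!: exI[of _ "axis 1 1 :: real^3"])
        then have d: "((1, 0), (span {e}, \<lambda>i\<in>{..<1}. e), 0) \<in> topspace D"
          using n by (auto simp: top_D)
        show ?thesis
          using f_eq[OF d] y1 by (intro image_eqI[OF _ d]) simp
      next
        case False
        then have "?A \<in> T ` ?I" using T by (auto simp: bij_betw_def)
        then obtain i where i: "i \<in> ?I" "T i = ?A" by blast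
        have "fst i \<ge> 1" using i(1) by auto
        then obtain l v t where lvt: "(l, v) \<in> topspace (taut_sphere_bundle (fst i))" "t \<in> {0<..1}"
            "cell n (T i) (r i) (fst i) v t = y"
          using cell_index.cell_surj[OF idx[OF i(1)] y i(2)] by blast
        then have d: "(i, (l, v), t) \<in> topspace D" using i(1) by (auto simp: top_D)
        show ?thesis
          using f_eq[OF d] lvt by (intro image_eqI[OF _ d]) auto
      qed
    qed
  qed
  ultimately have qf: "quotient_map D (stage n n) f"
    using compD Hausdorff_space_last_stage[OF n]
    by (intro continuous_closed_imp_quotient_map continuous_imp_closed_map) auto

  have "quotient_map (B i) (?X i) (\<lambda>(x, t). sus (taut_sphere_bundle (fst i)) x t)" for i
    by (cases i) (simp add: B_def quotient_map_sus)
  then have "quotient_map D (sum_topology ?X ?I)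
      (\<lambda>(i, x). (i, (\<lambda>(x, t). sus (taut_sphere_bundle (fst i)) x t) x))"
    unfolding D_def by (intro quotient_map_sum_topology)
  from quotient_map_compose[OF this quotient_map_wedge]
  have qg: "quotient_map D (wedge ?X ?p ?I) g"
    by (simp add: g_def o_def case_prod_unfold)

  have "f x = f y \<longleftrightarrow> g x = g y" if xy: "x \<in> topspace D" "y \<in> topspace D" for x y
  proof -
    obtain i l v t where x: "x = (i, (l, v), t)" by (metis surj_pair)
    obtain i' l' v' t' where y: "y = (i', (l', v'), t')" by (metis surj_pair)
    have X: "i \<in> ?I" "(l, v) \<in> topspace (taut_sphere_bundle (fst i))" "t \<in> {0..1}"
      and Y: "i' \<in> ?I" "(l', v') \<in> topspace (taut_sphere_bundle (fst i'))" "t' \<in> {0..1}"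
      using xy by (simp_all add: x y top_D)
    have in_susp: "sus (taut_sphere_bundle (fst i)) x t \<in> topspace (?X i)"
      if "x \<in> topspace (taut_sphere_bundle (fst i))" "t \<in> {0..1}" for i x t
      using that by (cases i) (force simp: topspace_suspension)
    let ?same = "i = i' \<and> t = t' \<and> ((l, v) = (l', v') \<or> t = 0 \<or> t = 1) \<or> t = 0 \<and> t' = 0"
    have "g x = g y \<longleftrightarrow>
        (i, sus (taut_sphere_bundle (fst i)) (l, v) t) = (i', sus (taut_sphere_bundle (fst i')) (l', v') t') \<or>
        sus (taut_sphere_bundle (fst i)) (l, v) t = ?p i \<and> sus (taut_sphere_bundle (fst i')) (l', v') t' = ?p i'"
      unfolding x y g_def case_prod_conv
      by (rule wedge_class_eq_iff[OF X(1) Y(1) in_susp[OF X(2,3)] in_susp[OF Y(2,3)]])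
    also have "\<dots> \<longleftrightarrow> ?same"
      using X Y sus_eq_iff[of "(l, v)" "taut_sphere_bundle (fst i)" "(l', v')" t t']
      by (auto simp: case_prod_unfold sus_eq_suspension_point_iff simp del: atLeastAtMost_iff)
    finally have G: "g x = g y \<longleftrightarrow> ?same" .
    have ff: "f x = (if t = 0 then one_tuple n else cell n (T i) (r i) (fst i) v t)"
        "f y = (if t' = 0 then one_tuple n else cell n (T i') (r i') (fst i') v' t')"
      using f_eq xy by (simp_all add: x y)
    have ne: "cell n (T i) (r i) (fst i) v t \<noteq> one_tuple n" if "t \<noteq> 0"
      using supp[OF xy(1)[unfolded x] that] Tne[OF X(1)] one_supp by metis
    have ne': "cell n (T i') (r i') (fst i') v' t' \<noteq> one_tuple n" if "t' \<noteq> 0"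
      using supp[OF xy(2)[unfolded y] that] Tne[OF Y(1)] one_supp by metis
    have inj: "i = i' \<and> t = t' \<and> ((l, v) = (l', v') \<or> t = 1)"
      if "t \<noteq> 0" "t' \<noteq> 0" "cell n (T i) (r i) (fst i) v t = cell n (T i') (r i') (fst i') v' t'"
    proof -
      have "T i = T i'"
        using supp[OF xy(1)[unfolded x] that(1)] supp[OF xy(2)[unfolded y] that(2)] that(3) by simp
      then have ii: "i = i'"
        by (rule inj_onD[OF bij_betw_imp_inj_on[OF T] _ X(1) Y(1)])
      have "t \<in> {0<..1}" "t' \<in> {0<..1}" using X(3) Y(3) that by auto
      then show ?thesis
        using cell_index.cell_inj[OF idx[OF X(1)] X(2) _ Y(2)[folded ii]] that(3) ii by simp
    qed
    have one: "cell n (T i) (r i) (fst i) v 1 = cell n (T i) (r i) (fst i) v' 1"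
      by (rule ext) (simp add: cell_def)
    show ?thesis
      unfolding G ff using ne ne' inj one by (cases "t = 0"; cases "t' = 0") auto
  qed
  then show ?thesis
    by (rule same_fibres_imp_homeomorphic_space[OF qf qg])
qed

theorem mainTheorem1:
  fixes n :: nat
  assumes "n \<ge> 1"
  shows "suspension (commuting_tuples n) homotopy_equivalent_space
    suspension
      (wedge (\<lambda>(k, j). suspension (taut_sphere_bundle k))
             (\<lambda>(k, j). suspension_point (taut_sphere_bundle k))
             (SIGMA k:{1..n}. {..<n choose k}))"
  using homotopy_eqv_trans[OF suspension_commuting_tuples_stage[OF order_refl]
      homeomorphic_imp_suspension_homotopy_equivalent[OF last_stage_homeomorphic_wedge[OF assms]]] .

end
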